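(* Let $f(x)=\frac1{|D|}\sum_{\xi_i\in D}f(x,\xi_i)$ on $\mathbb R^d$ satisfy $(L_0,L_1)$-generalized smoothness (with $L_0>0$, $L_1\ge0$) and the bounded variance assumption with constants $\tau_0>0$, $0\le\tau_1<1$ (both defined in the context). Given an arbitrary noise multiplier $\sigma$ and a constant $r\in(0,1]$, run DP-PSAC (defined in the context) for a number of iterations $T\ge A(L,\tau,d,r,\sigma,B)$ (defined in the context) with the constant learning rate $$\eta=\sqrt{\frac{2B^2}{d\sigma^2T\,(L_0+L_1(\tau_0+1))}} .$$ Then $$\mathbb E\Big(\min_{0\le t<T}\|\nabla f(x_t)\|\Big)\le \mathcal O\left(\sqrt[4]{\frac{d\sigma^2}{TB^2}}+\sqrt[4]{\frac{B^2}{Td\sigma^2}}\right)+\frac{8\tau_0^2(1+\tau_0)}{3N(\tau_0,\tau_1,r)(1-\tau_1)^3\left(\tau_0+\frac{r(1-\tau_1)}{2\tau_0+r(1-\tau_1)}\right)(2\sqrt r-r)},$$ where $$N(\tau_0,\tau_1,r)=\min\left(\frac{\tau_0}{1-\tau_1},\ \frac{2\tau_0^2+r\tau_0(1-\tau_1)}{4\tau_0^2+2r\tau_0(1-\tau_1)+r(1-\tau_1)^2}\right).$$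
   Context: $\|\cdot\|$ is the $\ell_2$ norm. $D$ is the (finite) training dataset and $f(x,\xi_i)$ is the loss at data point $\xi_i$. $(L_0,L_1)$-generalized smoothness: for all $x,y\in\mathbb R^d$, $\|\nabla f(x)-\nabla f(y)\|\le(L_0+L_1\|\nabla f(x)\|)\|x-y\|$. Bounded variance: for all $x\in\mathbb R^d$, the per-sample gradient $g(x,\xi_i)$ satisfies $\|g(x,\xi_i)-\nabla f(x)\|\le\tau_0+\tau_1\|\nabla f(x)\|$ with probability 1. DP-PSAC with clipping parameter $C$, batch size $B$ and learning rates $\eta_t$ (here $\eta_t=\eta$): starting from $x_0\in\mathbb R^d$, for $t=0,\dots,T-1$ sample a batch of $B$ data points uniformly with replacement from the dataset, let $g_{t,1},\dots,g_{t,B}$ be their gradients at $x_t$, set $$\widetilde g_{t,i}=C g_{t,i}\Big/\Big(\|g_{t,i}\|+\frac{r}{\|g_{t,i}\|+r}\Big),$$ and update $$x_{t+1}=x_t-\frac{\eta_t}{B}\Big(\sum_{i=1}^B\widetilde g_{t,i}+\mathcal N(0,C^2\sigma^2)\Big),$$ where $\mathcal N(0,C^2\sigma^2)$ is fresh Gaussian noise in $\mathbb R^d$ with variance $C^2\sigma^2$ in each coordinate. The threshold on $T$ is $$A(L,\tau,d,r,\sigma,B)=\max\left(\frac{32B^2\big(L_0(1-\tau_1)+L_1(\sqrt r-r+\tau_0)\big)^2}{d\sigma^2\Lambda(2\sqrt r-r)^2(1-\tau_1)^2\alpha^2},\ \frac{32B^2\big(L_0(1-\tau_1)+L_1\tau_0+L_1\sqrt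 r\big)^2}{d\sigma^2\Lambda(1-\tau_1)^2r\alpha^2},\ \frac{72L_1^2d\sigma^2}{\Lambda B^2}\right),$$ where $\Lambda=L_0+L_1(\tau_0+1)$ and $$\alpha=\tfrac14N(\tau_0,\tau_1,r)(1-\tau_1)\min\left(\frac{\sqrt r}{\sqrt r+\tau_0},\ \frac{2\sqrt r-r}{\sqrt r-r+\tau_0}\right).$$
   Formalization: f is additionally assumed bounded below (false otherwise: linear f with large gradient); the constant in O may depend on L0, L1, τ0, τ1, r, C and an upper bound Δ for f(x0) − inf f, but not on d, σ, B, T or the dataset. *)

theory Defs
  imports "HOL-Probability.Probability"
begin

text \<open>
  Points of d-dimensional Euclidean space are functions \<open>nat \<Rightarrow> real\<close> vanishing at all
  indices \<open>i \<ge> d\<close>, the carrier of \<^const>\<open>Euclidean_space\<close>. This makes the dimension a term,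
  so that the constant hidden in the O-notation can be chosen before the dimension.
\<close>

type_synonym rvec = "nat \<Rightarrow> real"

abbreviation Rn :: "nat \<Rightarrow> rvec set" where
  "Rn d \<equiv> topspace (Euclidean_space d)"

abbreviation vnorm :: "nat \<Rightarrow> rvec \<Rightarrow> real" where
  "vnorm d x \<equiv> L2_set x {..<d}"

text \<open>
  Frechet differentiability on \<open>Rn d\<close>. The limit is taken in the product topology on
  \<open>nat \<Rightarrow> real\<close>, which restricts to the usual topology of d-space on \<open>Rn d\<close>.
\<close>

definition has_gradient :: "nat \<Rightarrow> (rvec \<Rightarrow> real) \<Rightarrow> rvec \<Rightarrow> rvec \<Rightarrow> bool" where
  "has_gradient d F x v \<longleftrightarrow> v \<in> Rn d \<and>
     ((\<lambda>y. (F y - F x - (\<Sum>i<d. v i * (y i - x i))) / vnorm d (y - x)) \<longlongrightarrow> 0)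
       (at x within Rn d)"

definition differentiable_Rn :: "nat \<Rightarrow> (rvec \<Rightarrow> real) \<Rightarrow> bool" where
  "differentiable_Rn d F \<longleftrightarrow> (\<forall>x\<in>Rn d. \<exists>v. has_gradient d F x v)"

definition grad :: "nat \<Rightarrow> (rvec \<Rightarrow> real) \<Rightarrow> rvec \<Rightarrow> rvec" where
  "grad d F x = (THE v. has_gradient d F x v)"

lemma has_gradient_unique:
  assumes x: "x \<in> Rn d" and v: "has_gradient d F x v" and w: "has_gradient d F x w"
  shows "v = w"
proof (rule ccontr)
  assume "v \<noteq> w"
  define u where "u = w - v"
  have vw: "v \<in> Rn d" "w \<in> Rn d" using v w by (auto simp: has_gradient_def)
  obtain j where j: "v j \<noteq> w j" using \<open>v \<noteq> w\<close> by blast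
  with vw have "j < d" by (metis (mono_tags, lifting) topspace_Euclidean_space mem_Collect_eq not_le)
  have upos: "vnorm d u > 0"
  proof -
    have "\<bar>u j\<bar> \<le> vnorm d u" using \<open>j < d\<close>
      unfolding L2_set_def by (intro real_le_rsqrt) (auto intro: member_le_sum)
    then show ?thesis using j by (simp add: u_def)
  qed
  define p where "p = (\<lambda>s::real. \<lambda>i. x i + s * u i)"
  have p_Rn: "p s \<in> Rn d" for s
    using x vw by (simp add: p_def u_def topspace_Euclidean_space)
  have p_ne: "p s \<noteq> x" if "s > 0" for s
    using that j by (auto simp: p_def u_def fun_eq_iff intro!: exI[of _ j])
  have "continuous_on UNIV p"
    unfolding p_def by (intro continuous_on_coordinatewise_then_product) (auto intro!: continuous_intros)
  then have "isCont p 0" by (simp add: continuous_on_eq_continuous_at)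
  then have "(p \<longlongrightarrow> x) (at_right 0)"
    by (simp add: isCont_def p_def filterlim_at_split)
  then have lim: "filterlim p (at x within Rn d) (at_right 0)"
    by (auto simp: filterlim_at p_Rn eventually_at_filter intro!: always_eventually p_ne)
  have "((\<lambda>y. (F y - F x - (\<Sum>i<d. v i * (y i - x i))) / vnorm d (y - x)
           - (F y - F x - (\<Sum>i<d. w i * (y i - x i))) / vnorm d (y - x)) \<longlongrightarrow> 0 - 0) (at x within Rn d)"
    using v w unfolding has_gradient_def by (intro tendsto_diff) auto
  from filterlim_compose[OF this lim]
  have "((\<lambda>s. (F (p s) - F x - (\<Sum>i<d. v i * (p s i - x i))) / vnorm d (p s - x)
           - (F (p s) - F x - (\<Sum>i<d. w i * (p s i - x i))) / vnorm d (p s - x)) \<longlongrightarrow> 0) (at_right 0)"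
    by simp
  moreover have "(F (p s) - F x - (\<Sum>i<d. v i * (p s i - x i))) / vnorm d (p s - x)
           - (F (p s) - F x - (\<Sum>i<d. w i * (p s i - x i))) / vnorm d (p s - x) = vnorm d u"
    if "s > 0" for s
  proof -
    have n: "vnorm d (p s - x) = s * vnorm d u"
      using that by (simp add: p_def fun_diff_def L2_set_right_distrib)
    have "(\<Sum>i<d. w i * (p s i - x i)) - (\<Sum>i<d. v i * (p s i - x i)) = s * (\<Sum>i<d. (u i)\<^sup>2)"
      by (simp add: p_def u_def sum_subtractf[symmetric] sum_distrib_left power2_eq_square algebra_simps)
    also have "\<dots> = s * (vnorm d u)\<^sup>2"
      by (simp add: L2_set_def sum_nonneg)
    finally show ?thesis
      using that upos by (simp add: n diff_divide_distrib[symmetric] power2_eq_square)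
  qed
  ultimately have "((\<lambda>s. vnorm d u) \<longlongrightarrow> 0) (at_right (0::real))"
    by (auto elim!: Lim_transform_eventually simp: eventually_at_filter)
  then show False using upos by (simp add: tendsto_const_iff)
qed

lemma grad_eqI: "x \<in> Rn d \<Longrightarrow> has_gradient d F x v \<Longrightarrow> grad d F x = v"
  unfolding grad_def using has_gradient_unique by blast

text \<open>
  A dataset of \<open>m\<close> points is indexed by \<open>{..<m}\<close>; \<open>loss i x\<close> is the loss at the \<open>i\<close>-th data point.
\<close>

definition avg_loss :: "nat \<Rightarrow> (nat \<Rightarrow> rvec \<Rightarrow> real) \<Rightarrow> rvec \<Rightarrow> real" where
  "avg_loss m loss x = (\<Sum>i<m. loss i x) / real m"

definition unif_data :: "nat \<Rightarrow> nat measure" where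
  "unif_data m = measure_pmf (pmf_of_set {..<m})"

definition gen_smooth :: "nat \<Rightarrow> real \<Rightarrow> real \<Rightarrow> (rvec \<Rightarrow> real) \<Rightarrow> bool" where
  "gen_smooth d L0 L1 F \<longleftrightarrow> (\<forall>x\<in>Rn d. \<forall>y\<in>Rn d.
     vnorm d (grad d F x - grad d F y) \<le> (L0 + L1 * vnorm d (grad d F x)) * vnorm d (x - y))"

definition bounded_variance ::
    "nat \<Rightarrow> nat \<Rightarrow> real \<Rightarrow> real \<Rightarrow> (nat \<Rightarrow> rvec \<Rightarrow> real) \<Rightarrow> bool" where
  "bounded_variance d m \<tau>0 \<tau>1 loss \<longleftrightarrow> (\<forall>x\<in>Rn d. AE i in unif_data m.
     vnorm d (grad d (loss i) x - grad d (avg_loss m loss) x)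
       \<le> \<tau>0 + \<tau>1 * vnorm d (grad d (avg_loss m loss) x))"

definition clip :: "nat \<Rightarrow> real \<Rightarrow> real \<Rightarrow> rvec \<Rightarrow> rvec" where
  "clip d C r g = (\<lambda>i. C * g i / (vnorm d g + r / (vnorm d g + r)))"

text \<open>
  The randomness of one step is a pair of a batch \<open>b\<close>, whose \<open>j\<close>-th entry is the index of the
  \<open>j\<close>-th sampled data point, and a Gaussian noise vector \<open>z\<close>. The second argument of
  \<^const>\<open>normal_density\<close> is the standard deviation.
\<close>

definition batch_measure :: "nat \<Rightarrow> nat \<Rightarrow> (nat \<Rightarrow> nat) measure" where
  "batch_measure m B = Pi\<^sub>M {..<B} (\<lambda>_. unif_data m)"

definition gauss_measure :: "nat \<Rightarrow> real \<Rightarrow> rvec measure" where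
  "gauss_measure d s = Pi\<^sub>M {..<d} (\<lambda>_. density lborel (\<lambda>u. ennreal (normal_density 0 s u)))"

definition psac_measure ::
    "nat \<Rightarrow> nat \<Rightarrow> nat \<Rightarrow> real \<Rightarrow> real \<Rightarrow> nat \<Rightarrow> (nat \<Rightarrow> (nat \<Rightarrow> nat) \<times> rvec) measure" where
  "psac_measure d m B C \<sigma> T =
     Pi\<^sub>M {..<T} (\<lambda>_. batch_measure m B \<Otimes>\<^sub>M gauss_measure d (C * \<sigma>))"

text \<open>
  The noise vector is \<open>undefined\<close>, not zero, at indices \<open>i \<ge> d\<close>; the case distinction below
  keeps the iterates in \<open>Rn d\<close>.
\<close>

fun psac :: "nat \<Rightarrow> (nat \<Rightarrow> rvec \<Rightarrow> real) \<Rightarrow> nat \<Rightarrow> real \<Rightarrow> real \<Rightarrow> (nat \<Rightarrow> real) \<Rightarrow> rvec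
    \<Rightarrow> (nat \<Rightarrow> (nat \<Rightarrow> nat) \<times> rvec) \<Rightarrow> nat \<Rightarrow> rvec" where
  "psac d loss B C r \<eta> x0 \<omega> 0 = x0"
| "psac d loss B C r \<eta> x0 \<omega> (Suc t) =
     (let x = psac d loss B C r \<eta> x0 \<omega> t; (b, z) = \<omega> t in
      (\<lambda>i. if i < d
           then x i - \<eta> t / real B * ((\<Sum>j<B. clip d C r (grad d (loss (b j)) x) i) + z i)
           else 0))"

definition N_const :: "real \<Rightarrow> real \<Rightarrow> real \<Rightarrow> real" where
  "N_const \<tau>0 \<tau>1 r =
     min (\<tau>0 / (1 - \<tau>1))
         ((2 * \<tau>0\<^sup>2 + r * \<tau>0 * (1 - \<tau>1)) /
          (4 * \<tau>0\<^sup>2 + 2 * r * \<tau>0 * (1 - \<tau>1) + r * (1 - \<tau>1)\<^sup>2))"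

definition alpha_const :: "real \<Rightarrow> real \<Rightarrow> real \<Rightarrow> real" where
  "alpha_const \<tau>0 \<tau>1 r = 1 / 4 * N_const \<tau>0 \<tau>1 r * (1 - \<tau>1) *
     min (sqrt r / (sqrt r + \<tau>0)) ((2 * sqrt r - r) / (sqrt r - r + \<tau>0))"

definition Lambda_const :: "real \<Rightarrow> real \<Rightarrow> real \<Rightarrow> real" where
  "Lambda_const L0 L1 \<tau>0 = L0 + L1 * (\<tau>0 + 1)"

definition A_threshold ::
    "real \<Rightarrow> real \<Rightarrow> real \<Rightarrow> real \<Rightarrow> nat \<Rightarrow> real \<Rightarrow> real \<Rightarrow> nat \<Rightarrow> real" where
  "A_threshold L0 L1 \<tau>0 \<tau>1 d r \<sigma> B =
     (let \<Lambda> = Lambda_const L0 L1 \<tau>0; \<alpha> = alpha_const \<tau>0 \<tau>1 r in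
      Max {32 * (real B)\<^sup>2 * (L0 * (1 - \<tau>1) + L1 * (sqrt r - r + \<tau>0))\<^sup>2 /
             (real d * \<sigma>\<^sup>2 * \<Lambda> * (2 * sqrt r - r)\<^sup>2 * (1 - \<tau>1)\<^sup>2 * \<alpha>\<^sup>2),
           32 * (real B)\<^sup>2 * (L0 * (1 - \<tau>1) + L1 * \<tau>0 + L1 * sqrt r)\<^sup>2 /
             (real d * \<sigma>\<^sup>2 * \<Lambda> * (1 - \<tau>1)\<^sup>2 * r * \<alpha>\<^sup>2),
           72 * L1\<^sup>2 * real d * \<sigma>\<^sup>2 / (\<Lambda> * (real B)\<^sup>2)})"

definition bias_term :: "real \<Rightarrow> real \<Rightarrow> real \<Rightarrow> real" where
  "bias_term \<tau>0 \<tau>1 r =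
     8 * \<tau>0\<^sup>2 * (1 + \<tau>0) /
     (3 * N_const \<tau>0 \<tau>1 r * (1 - \<tau>1) ^ 3 *
        (\<tau>0 + r * (1 - \<tau>1) / (2 * \<tau>0 + r * (1 - \<tau>1))) * (2 * sqrt r - r))"

end

theory Submission
  imports Defs
begin

text \<open>
  The bias term is at least \<open>2 \<tau>0 / (1 - \<tau>1)\<close>. While the gradient norm stays above this level, every
  per-sample gradient has a positive component along the full gradient, and so does its clipped version,
  by at least a fixed multiple of \<open>C\<close> times the gradient norm. The descent inequality with the gradient
  constant frozen at the current point then bounds the expected sum of gradient norms up to the first
  visit below that level, and the minimum is at most the level plus the average of this stopped sum.
  This needs a step size that is small compared with a constant depending on \<open>C\<close>, i.e. both
  \<open>D / T\<close> and \<open>1 / (D T)\<close> small for \<open>D = d \<sigma>\<^sup>2 / B\<^sup>2\<close>. Otherwise one of the two fourth roots is bounded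
  below, and the gradient norm at \<open>x0\<close>, which smoothness and the optimality gap bound by a constant,
  is absorbed into the O-term.
\<close>

section \<open>Inner product and norm on \<open>Rn d\<close>\<close>

abbreviation vdot :: "nat \<Rightarrow> rvec \<Rightarrow> rvec \<Rightarrow> real" where
  "vdot d u v \<equiv> (\<Sum>i<d. u i * v i)"

lemma Rn_iff: "x \<in> Rn d \<longleftrightarrow> (\<forall>i\<ge>d. x i = 0)"
  by (simp add: topspace_Euclidean_space)

lemma vnorm_power2: "(vnorm d x)\<^sup>2 = (\<Sum>i<d. (x i)\<^sup>2)"
  by (simp add: L2_set_def sum_nonneg)

lemma vdot_self: "vdot d x x = (vnorm d x)\<^sup>2"
  unfolding vnorm_power2 by (simp add: power2_eq_square)

lemma vdot_le_vnorm: "\<bar>vdot d u v\<bar> \<le> vnorm d u * vnorm d v"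
proof -
  have "\<bar>vdot d u v\<bar> \<le> (\<Sum>i<d. \<bar>u i\<bar> * \<bar>v i\<bar>)"
    by (rule order_trans[OF sum_abs]) (simp add: abs_mult)
  also have "\<dots> \<le> vnorm d u * vnorm d v"
    by (rule L2_set_mult_ineq)
  finally show ?thesis .
qed

lemma vnorm_add_le: "vnorm d (\<lambda>i. u i + v i) \<le> vnorm d u + vnorm d v"
  by (rule L2_set_triangle_ineq)

lemma vnorm_scale: "vnorm d (\<lambda>i. c * u i) = \<bar>c\<bar> * vnorm d u"
  by (simp add: L2_set_def power_mult_distrib sum_distrib_left[symmetric] real_sqrt_mult)

lemma vnorm_sum_le: "finite A \<Longrightarrow> vnorm d (\<lambda>i. \<Sum>j\<in>A. u j i) \<le> (\<Sum>j\<in>A. vnorm d (u j))"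
proof (induction A rule: finite_induct)
  case (insert a A)
  have "vnorm d (\<lambda>i. \<Sum>j\<in>insert a A. u j i) = vnorm d (\<lambda>i. u a i + (\<Sum>j\<in>A. u j i))"
    using insert by simp
  also have "\<dots> \<le> vnorm d (u a) + vnorm d (\<lambda>i. \<Sum>j\<in>A. u j i)"
    by (rule vnorm_add_le)
  finally show ?case using insert by simp
qed (simp add: L2_set_def)

lemma vnorm_diff_pos:
  assumes "x \<in> Rn d" "y \<in> Rn d" "y \<noteq> x"
  shows "vnorm d (y - x) > 0"
proof -
  obtain j where j: "y j \<noteq> x j" using assms by blast
  have "j < d" using assms(1,2) j by (metis Rn_iff not_le)
  then have "vnorm d (y - x) \<noteq> 0"
    using j by (auto simp: L2_set_eq_0_iff)
  then show ?thesis using L2_set_nonneg[of "y - x" "{..<d}"] by linarith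
qed

section \<open>Gradients and generalized smoothness\<close>

lemma has_gradient_grad:
  assumes "differentiable_Rn d F" "x \<in> Rn d"
  shows "has_gradient d F x (grad d F x)"
  using assms grad_eqI unfolding differentiable_Rn_def by metis

lemma grad_in_Rn:
  assumes "differentiable_Rn d F" "x \<in> Rn d"
  shows "grad d F x \<in> Rn d"
  using has_gradient_grad[OF assms] by (simp add: has_gradient_def)

text \<open>Off \<open>x\<close>, \<open>F\<close> is the difference quotient times the distance,
  plus a linear term and a constant, and each piece converges. Continuity is what later makes
  \<open>F\<close> Borel measurable.\<close>

lemma has_gradient_isCont:
  assumes x: "x \<in> Rn d" and v: "has_gradient d F x v"
  shows "continuous (at x within Rn d) F"
proof -
  let ?q = "\<lambda>y. (F y - F x - (\<Sum>i<d. v i * (y i - x i))) / vnorm d (y - x)"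
  have coord: "((\<lambda>y. y i) \<longlongrightarrow> x i) (at x within Rn d)" for i
  proof -
    have "continuous_on UNIV (\<lambda>y::rvec. y i)" by (rule continuous_on_product_coordinates)
    then show ?thesis
      by (metis continuous_on_def iso_tuple_UNIV_I tendsto_within_subset top_greatest)
  qed
  have 1: "((\<lambda>y. vnorm d (y - x)) \<longlongrightarrow> sqrt (\<Sum>i<d. (x i - x i)\<^sup>2)) (at x within Rn d)"
    unfolding L2_set_def fun_diff_def by (intro tendsto_intros coord)
  have 2: "((\<lambda>y. \<Sum>i<d. v i * (y i - x i)) \<longlongrightarrow> (\<Sum>i<d. v i * (x i - x i))) (at x within Rn d)"
    by (intro tendsto_intros coord)
  have "((\<lambda>y. ?q y * vnorm d (y - x) + (\<Sum>i<d. v i * (y i - x i)) + F x) \<longlongrightarrow> 0 * 0 + 0 + F x)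
      (at x within Rn d)"
    using v 1 2 unfolding has_gradient_def by (intro tendsto_intros) auto
  moreover have "\<forall>\<^sub>F y in at x within Rn d.
      ?q y * vnorm d (y - x) + (\<Sum>i<d. v i * (y i - x i)) + F x = F y"
    unfolding eventually_at_filter
    by (rule always_eventually) (use vnorm_diff_pos[OF x] in fastforce)
  ultimately have "(F \<longlongrightarrow> F x) (at x within Rn d)"
    by (auto elim: Lim_transform_eventually)
  then show ?thesis by (simp add: continuous_within)
qed

text \<open>Along the line the distance to \<open>x\<close> is \<open>\<bar>s\<bar>\<close> times
  the norm of \<open>w\<close>, so composing the defining limit with the line yields the derivative.
  The zero direction is separate because the path then never leaves \<open>x\<close>, which the
  punctured limit excludes.\<close>

lemma has_gradient_line:
  assumes x: "x \<in> Rn d" and w: "w \<in> Rn d" and v: "has_gradient d F x v"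
  shows "((\<lambda>s. F (\<lambda>i. x i + s * w i)) has_real_derivative vdot d v w) (at 0)"
proof (cases "w = (\<lambda>i. 0)")
  case True
  then show ?thesis by simp
next
  case False
  define p where "p = (\<lambda>s::real. \<lambda>i. x i + s * w i)"
  have p_Rn: "p s \<in> Rn d" for s
    using x w by (simp add: p_def Rn_iff)
  have p0: "p 0 = x" by (simp add: p_def)
  have p_ne: "p s \<noteq> x" if "s \<noteq> 0" for s
    using that False by (auto simp: p_def fun_eq_iff)
  have n: "vnorm d (p s - x) = \<bar>s\<bar> * vnorm d w" for s
    by (simp add: p_def fun_diff_def vnorm_scale)
  have wpos: "vnorm d w > 0"
    using vnorm_diff_pos[of "\<lambda>i. 0" d w] w False by (simp add: Rn_iff fun_diff_def)
  have "continuous_on UNIV p"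
    unfolding p_def by (intro continuous_on_coordinatewise_then_product) (auto intro!: continuous_intros)
  then have "isCont p 0" by (simp add: continuous_on_eq_continuous_at)
  then have "(p \<longlongrightarrow> x) (at 0)" by (simp add: isCont_def p0)
  then have lim: "filterlim p (at x within Rn d) (at 0)"
    by (auto simp: filterlim_at p_Rn eventually_at_filter intro!: always_eventually p_ne)
  have "((\<lambda>y. (F y - F x - (\<Sum>i<d. v i * (y i - x i))) / vnorm d (y - x)) \<longlongrightarrow> 0) (at x within Rn d)"
    using v by (simp add: has_gradient_def)
  from filterlim_compose[OF this lim]
  have "((\<lambda>s. (F (p s) - F x - s * vdot d v w) / (\<bar>s\<bar> * vnorm d w)) \<longlongrightarrow> 0) (at 0)"
    unfolding n by (simp add: p_def sum_distrib_left mult_ac)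
  then have "((\<lambda>s. (F (p s) - F x - s * vdot d v w) / (\<bar>s\<bar> * vnorm d w) * vnorm d w) \<longlongrightarrow> 0 * vnorm d w) (at 0)"
    by (intro tendsto_intros)
  moreover have "(F (p s) - F x - s * vdot d v w) / (\<bar>s\<bar> * vnorm d w) * vnorm d w
      = (F (p s) - F x - s * vdot d v w) / \<bar>s\<bar>" for s
    using wpos by simp
  \<comment> \<open>The quotient so far has \<open>\<bar>s\<bar>\<close> in the denominator, a
    derivative needs \<open>s\<close>. The two agree in absolute value, which suffices because the
    limit is zero.\<close>
  ultimately have "((\<lambda>s. \<bar>(F (p s) - F x - s * vdot d v w) / \<bar>s\<bar>\<bar>) \<longlongrightarrow> 0) (at 0)"
    by (intro tendsto_rabs_zero) simp
  then have "((\<lambda>s. \<bar>(F (p s) - F x - s * vdot d v w) / s\<bar>) \<longlongrightarrow> 0) (at 0)"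
    by simp
  then have "((\<lambda>s. (F (p s) - F x - s * vdot d v w) / s) \<longlongrightarrow> 0) (at 0)"
    by (rule tendsto_rabs_zero_cancel)
  then have "((\<lambda>s. (F (p s) - F x - s * vdot d v w) / s + vdot d v w) \<longlongrightarrow> 0 + vdot d v w) (at 0)"
    by (intro tendsto_intros)
  then have "((\<lambda>s. (F (p s) - F x) / s) \<longlongrightarrow> 0 + vdot d v w) (at 0)"
    by (rule Lim_transform_eventually) (auto simp: eventually_at_filter field_simps)
  then show ?thesis
    by (simp add: has_field_derivative_iff p0[symmetric]) (simp add: p_def)
qed

text \<open>Differentiating at \<open>s\<close> amounts to differentiating at zero along the same
  line re-based at its point for parameter \<open>s\<close>.\<close>

lemma has_gradient_line_at:
  assumes F: "differentiable_Rn d F" and x: "x \<in> Rn d" and w: "w \<in> Rn d"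
  shows "((\<lambda>s. F (\<lambda>i. x i + s * w i)) has_real_derivative
    vdot d (grad d F (\<lambda>i. x i + s * w i)) w) (at s)"
proof -
  let ?y = "\<lambda>i. x i + s * w i"
  have y: "?y \<in> Rn d" using x w by (simp add: Rn_iff)
  have "((\<lambda>h. F (\<lambda>i. ?y i + h * w i)) has_real_derivative vdot d (grad d F ?y) w) (at 0)"
    by (rule has_gradient_line[OF y w has_gradient_grad[OF F y]])
  then show ?thesis
    by (simp add: DERIV_at_within_shift_lemma field_has_derivative_at DERIV_shift[of _ _ 0 s, simplified] algebra_simps)
qed

lemma has_gradient_avg_loss:
  assumes x: "x \<in> Rn d" and v: "\<And>k. k < m \<Longrightarrow> has_gradient d (loss k) x (v k)"
  shows "has_gradient d (avg_loss m loss) x (\<lambda>i. (\<Sum>k<m. v k i) / real m)"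
proof -
  have "((\<lambda>y. (\<Sum>k<m. (loss k y - loss k x - (\<Sum>i<d. v k i * (y i - x i))) / vnorm d (y - x)) / real m)
     \<longlongrightarrow> (\<Sum>k<m. 0) / real m) (at x within Rn d)"
    using v unfolding has_gradient_def divide_inverse by (intro tendsto_intros) auto
  moreover have "(\<Sum>k<m. (loss k y - loss k x - (\<Sum>i<d. v k i * (y i - x i))) / vnorm d (y - x)) / real m
     = (avg_loss m loss y - avg_loss m loss x - (\<Sum>i<d. (\<Sum>k<m. v k i) / real m * (y i - x i))) / vnorm d (y - x)" for y
  proof -
    have "(\<Sum>i<d. (\<Sum>k<m. v k i) / real m * (y i - x i)) = (\<Sum>k<m. \<Sum>i<d. v k i * (y i - x i)) / real m"
      by (subst sum.swap) (simp add: sum_divide_distrib sum_distrib_right)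
    then show ?thesis
      by (simp only: avg_loss_def sum_subtractf sum_divide_distrib[symmetric] diff_divide_distrib)
         (simp add: mult.commute)
  qed
  ultimately show ?thesis
    using v unfolding has_gradient_def by (auto simp: Rn_iff)
qed

lemma differentiable_avg_loss:
  assumes "\<And>k. k < m \<Longrightarrow> differentiable_Rn d (loss k)"
  shows "differentiable_Rn d (avg_loss m loss)"
  unfolding differentiable_Rn_def
proof
  fix x assume x: "x \<in> Rn d"
  show "\<exists>v. has_gradient d (avg_loss m loss) x v"
    using has_gradient_avg_loss[where v = "\<lambda>k. grad d (loss k) x", OF x has_gradient_grad[OF assms x]]
    by blast
qed

text \<open>The coefficient in \<open>gen_smooth\<close> is evaluated at the first argument only.
  Keeping \<open>x\<close> there fixes one Lipschitz constant \<open>M\<close> along the whole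
  segment, for steps of any length, so the classical quadratic bound follows: \<open>\<phi>\<close>
  is nonincreasing on the unit interval.\<close>

lemma gen_smooth_descent:
  assumes F: "differentiable_Rn d F" and sm: "gen_smooth d L0 L1 F"
    and L: "L0 \<ge> 0" "L1 \<ge> 0" and x: "x \<in> Rn d" and w: "w \<in> Rn d"
  shows "F (\<lambda>i. x i + w i) \<le> F x + vdot d (grad d F x) w
           + (L0 + L1 * vnorm d (grad d F x)) / 2 * (vnorm d w)\<^sup>2"
proof -
  define M where "M = L0 + L1 * vnorm d (grad d F x)"
  define \<phi> where "\<phi> = (\<lambda>s. F (\<lambda>i. x i + s * w i) - s * vdot d (grad d F x) w - M / 2 * s\<^sup>2 * (vnorm d w)\<^sup>2)"
  define \<phi>' where "\<phi>' = (\<lambda>s. vdot d (grad d F (\<lambda>i. x i + s * w i)) w - vdot d (grad d F x) w - M * s * (vnorm d w)\<^sup>2)"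
  have der: "(\<phi> has_real_derivative \<phi>' s) (at s)" for s
    unfolding \<phi>_def \<phi>'_def
    by (rule derivative_eq_intros has_gradient_line_at[OF F x w] refl)+ simp
  have nonpos: "\<phi>' s \<le> 0" if s: "0 \<le> s" for s
  proof -
    let ?y = "\<lambda>i. x i + s * w i"
    let ?g = "grad d F ?y - grad d F x"
    have y: "?y \<in> Rn d" using x w by (simp add: Rn_iff)
    have "vnorm d (x - ?y) = s * vnorm d w"
      using vnorm_scale[where d = d and c = "-s" and u = w] s by (simp add: fun_diff_def)
    moreover have "vnorm d (grad d F x - grad d F ?y) = vnorm d ?g"
      by (simp add: L2_set_def power2_commute)
    moreover have "vnorm d (grad d F x - grad d F ?y) \<le> M * vnorm d (x - ?y)"
      using sm x y unfolding gen_smooth_def M_def by blast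
    ultimately have g: "vnorm d ?g \<le> M * (s * vnorm d w)" by simp
    have "vdot d (grad d F ?y) w - vdot d (grad d F x) w = vdot d ?g w"
      by (simp add: sum_subtractf[symmetric] algebra_simps)
    also have "\<dots> \<le> vnorm d ?g * vnorm d w"
      using vdot_le_vnorm[where d = d and u = "?g" and v = w] by linarith
    also have "\<dots> \<le> M * (s * vnorm d w) * vnorm d w"
      by (rule mult_right_mono[OF g]) simp
    finally show ?thesis by (simp add: \<phi>'_def power2_eq_square mult_ac)
  qed
  have "\<phi> 1 \<le> \<phi> 0"
    by (rule DERIV_nonpos_imp_nonincreasing[of 0 1 \<phi>]) (use der nonpos in auto)
  then show ?thesis by (simp add: \<phi>_def M_def)
qed

text \<open>A single gradient step from \<open>x\<close> cannot lower \<open>F\<close> by more than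
  \<open>\<Delta>\<close>, while the descent inequality promises a decrease of
  \<open>u\<^sup>2 / (2 * M)\<close>. Here \<open>M\<close> grows only linearly in \<open>u\<close>,
  so this bounds \<open>u\<close>.\<close>

lemma gen_smooth_grad_bound:
  assumes F: "differentiable_Rn d F" and sm: "gen_smooth d L0 L1 F"
    and L: "L0 > 0" "L1 \<ge> 0" and x: "x \<in> Rn d"
    and low: "\<And>y. y \<in> Rn d \<Longrightarrow> F x - F y \<le> \<Delta>"
  shows "vnorm d (grad d F x) \<le> 1 + 2 * \<Delta> * (L0 + L1)"
proof (cases "vnorm d (grad d F x) \<le> 1")
  case True
  have "0 \<le> \<Delta>" using low[OF x] by simp
  then show ?thesis using True L by (simp add: add_increasing2)
next
  case False
  define u where "u = vnorm d (grad d F x)"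
  define M where "M = L0 + L1 * u"
  have u: "u > 1" using False by (simp add: u_def)
  have M: "M > 0" unfolding M_def using L u by (simp add: add_pos_nonneg)
  \<comment> \<open>The step length \<open>1 / M\<close> minimizes the quadratic upper bound along
    the negative gradient.\<close>
  let ?w = "\<lambda>i. - (1 / M) * grad d F x i"
  have w: "?w \<in> Rn d" using grad_in_Rn[OF F x] by (simp add: Rn_iff)
  have xw: "(\<lambda>i. x i + ?w i) \<in> Rn d" using x w by (simp add: Rn_iff)
  have dot: "vdot d (grad d F x) ?w = - (1 / M) * u\<^sup>2"
  proof -
    have "vdot d (grad d F x) ?w = (\<Sum>i<d. - (1 / M) * (grad d F x i * grad d F x i))"
      by (rule sum.cong) (auto simp: mult_ac)
    then show ?thesis
      unfolding sum_distrib_left[symmetric] u_def vdot_self[symmetric] by simp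
  qed
  have nrm: "(vnorm d ?w)\<^sup>2 = (1 / M)\<^sup>2 * u\<^sup>2"
    unfolding vnorm_scale u_def by (simp only: power_mult_distrib power2_abs) simp
  have "F (\<lambda>i. x i + ?w i) \<le> F x - 1 / M * u\<^sup>2 + M / 2 * ((1 / M)\<^sup>2 * u\<^sup>2)"
    using gen_smooth_descent[OF F sm _ _ x w] L dot nrm unfolding M_def u_def by simp
  then have "u\<^sup>2 / (2 * M) \<le> \<Delta>"
  proof -
    have "F x - 1 / M * u\<^sup>2 + M / 2 * ((1 / M)\<^sup>2 * u\<^sup>2) = F x - u\<^sup>2 / (2 * M)"
      using M by (simp add: power2_eq_square field_simps)
    then show ?thesis
      using \<open>F (\<lambda>i. x i + ?w i) \<le> _\<close> low[OF xw] by linarith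
  qed
  then have "u\<^sup>2 \<le> 2 * \<Delta> * M" using M by (simp add: field_simps)
  \<comment> \<open>For \<open>u > 1\<close> the constant \<open>M\<close> is at most
    \<open>(L0 + L1) * u\<close>, so one factor \<open>u\<close> cancels.\<close>
  also have "\<dots> \<le> 2 * \<Delta> * ((L0 + L1) * u)"
    using low[OF x] L u by (intro mult_left_mono) (auto simp: M_def algebra_simps)
  finally have "u \<le> 2 * \<Delta> * (L0 + L1)" using u by (simp add: power2_eq_square)
  then show ?thesis by (simp add: u_def)
qed

section \<open>Alignment of clipped gradients\<close>

lemma clip_denom_pos:
  assumes "r > 0"
  shows "vnorm d g + r / (vnorm d g + r) > 0"
  using assms by (intro add_nonneg_pos divide_pos_pos) (auto simp: add_nonneg_pos)

lemma vnorm_clip_le: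
  assumes "C > 0" "r > 0"
  shows "vnorm d (clip d C r g) \<le> C"
proof -
  let ?D = "vnorm d g + r / (vnorm d g + r)"
  have "vnorm d (clip d C r g) = \<bar>C / ?D\<bar> * vnorm d g"
    using vnorm_scale[where d = d and c = "C / ?D" and u = g] by (simp add: clip_def)
  also have "\<dots> = C * (vnorm d g / ?D)"
    using clip_denom_pos[OF assms(2), where d = d and g = g] assms by simp
  also have "\<dots> \<le> C * 1"
    using assms clip_denom_pos[OF assms(2), where d = d and g = g]
    by (intro mult_left_mono) (auto simp: less_imp_le)
  finally show ?thesis by simp
qed

text \<open>Above this gradient norm every per-sample deviation is at most \<open>1 - (1 - \<tau>1) / 2\<close> times the norm
  of the full gradient.\<close>

definition grad_floor :: "real \<Rightarrow> real \<Rightarrow> real" where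
  "grad_floor \<tau>0 \<tau>1 = 2 * \<tau>0 / (1 - \<tau>1)"

text \<open>The first factor is the alignment left after the worst deviation. The second is the
  smallest value, attained at the floor, of \<open>u / (2 * u + 1)\<close>, which bounds the
  gradient norm over the clipping denominator from below uniformly in \<open>r\<close>.\<close>

definition clip_rate :: "real \<Rightarrow> real \<Rightarrow> real" where
  "clip_rate \<tau>0 \<tau>1 = (1 - \<tau>1) / 2 * (grad_floor \<tau>0 \<tau>1 / (2 * grad_floor \<tau>0 \<tau>1 + 1))"

lemma clip_rate_pos: "\<tau>0 > 0 \<Longrightarrow> \<tau>1 < 1 \<Longrightarrow> clip_rate \<tau>0 \<tau>1 > 0"
  unfolding clip_rate_def grad_floor_def by (intro mult_pos_pos divide_pos_pos add_pos_pos) auto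

text \<open>Above the floor the deviation of \<open>g\<close> from \<open>v\<close> is at most
  \<open>u - u * s / 2\<close>. By Cauchy-Schwarz the component of \<open>g\<close> along
  \<open>v\<close> stays positive, and by the triangle inequality \<open>g\<close> has norm at most
  \<open>2 * u\<close>, which bounds the clipping denominator by \<open>2 * u + 1\<close>.\<close>

lemma vdot_clip_ge:
  assumes \<tau>: "\<tau>0 > 0" "0 \<le> \<tau>1" "\<tau>1 < 1" and r: "0 < r" "r \<le> 1" and C: "C > 0"
    and dev: "vnorm d (g - v) \<le> \<tau>0 + \<tau>1 * vnorm d v"
    and big: "grad_floor \<tau>0 \<tau>1 \<le> vnorm d v"
  shows "vdot d v (clip d C r g) \<ge> C * clip_rate \<tau>0 \<tau>1 * vnorm d v"
proof -
  define u where "u = vnorm d v"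
  define s where "s = 1 - \<tau>1"
  define G where "G = grad_floor \<tau>0 \<tau>1"
  let ?D = "vnorm d g + r / (vnorm d g + r)"
  have s: "0 < s" using \<tau> by (simp add: s_def)
  have G: "0 < G" "G \<le> u" using \<tau> big by (auto simp: G_def grad_floor_def u_def)
  \<comment> \<open>The floor is chosen so that the additive part \<open>\<tau>0\<close> of the
    deviation uses up at most half of the margin \<open>u * s\<close> left by the multiplicative
    part.\<close>
  have "G * s = 2 * \<tau>0" using s by (simp add: G_def grad_floor_def s_def)
  moreover have "G * s \<le> u * s" using G s by (intro mult_right_mono) auto
  ultimately have "\<tau>0 \<le> u * s / 2" by simp
  then have dev': "vnorm d (g - v) \<le> u - u * s / 2"
    using dev unfolding u_def[symmetric] s_def by (simp add: field_simps)
  have "vdot d v g = vdot d v v + vdot d v (g - v)"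
    by (simp add: sum.distrib[symmetric] algebra_simps)
  moreover have "- vdot d v (g - v) \<le> u * vnorm d (g - v)"
    using vdot_le_vnorm[where d = d and u = v and v = "g - v"] by (simp add: u_def)
  moreover have "u * vnorm d (g - v) \<le> u * (u - u * s / 2)"
    using dev' G by (intro mult_left_mono) auto
  ultimately have dot: "vdot d v g \<ge> s / 2 * u\<^sup>2"
    unfolding vdot_self u_def[symmetric] by (simp add: power2_eq_square algebra_simps)
  have "vnorm d g \<le> vnorm d v + vnorm d (g - v)"
    using vnorm_add_le[where d = d and u = v and v = "g - v"] by simp
  moreover have "0 \<le> u * s / 2" using G s by simp
  ultimately have ng: "vnorm d g \<le> 2 * u"
    using dev' unfolding u_def[symmetric] by linarith
  have "r / (vnorm d g + r) \<le> 1" using r by (simp add: divide_le_eq_1 add_nonneg_pos)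
  then have D: "?D \<le> 2 * u + 1" using ng by linarith
  have D0: "?D > 0" by (rule clip_denom_pos[OF r(1)])
  have "G / (2 * G + 1) \<le> u / (2 * u + 1)"
    using G by (simp add: field_simps)
  then have "C * (s / 2 * (G / (2 * G + 1))) * u \<le> C * (s / 2 * (u / (2 * u + 1))) * u"
    using C s G by (intro mult_right_mono mult_left_mono) auto
  also have "\<dots> = C * (s / 2 * u\<^sup>2) / (2 * u + 1)" by (simp add: power2_eq_square)
  also have "\<dots> \<le> C * vdot d v g / (2 * u + 1)"
    using C dot G by (intro divide_right_mono mult_left_mono) auto
  also have "\<dots> \<le> C * vdot d v g / ?D"
  proof (rule divide_left_mono[OF D])
    have "0 \<le> s / 2 * u\<^sup>2" using s by simp
    then show "0 \<le> C * vdot d v g" using C dot by simp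
    show "0 < (2 * u + 1) * ?D" using D0 G by (intro mult_pos_pos) auto
  qed
  also have "\<dots> = vdot d v (clip d C r g)"
    by (simp add: clip_def sum_divide_distrib sum_distrib_left mult_ac)
  finally show ?thesis by (simp add: clip_rate_def G_def s_def u_def mult_ac)
qed

text \<open>Bounding \<open>N\<close> by \<open>\<tau>0 / s\<close> and both \<open>q\<close> and
  \<open>w\<close> by one enlarges the denominator of the bias and leaves
  \<open>8 * \<tau>0 / (3 * s\<^sup>2)\<close>. This dominates \<open>2 * \<tau>0 / s\<close>
  because \<open>s \<le> 1\<close>.\<close>

lemma grad_floor_le_bias_term:
  assumes \<tau>: "\<tau>0 > 0" "0 \<le> \<tau>1" "\<tau>1 < 1" and r: "0 < r" "r \<le> 1"
  shows "grad_floor \<tau>0 \<tau>1 \<le> bias_term \<tau>0 \<tau>1 r"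
proof -
  define s where "s = 1 - \<tau>1"
  define q where "q = r * s / (2 * \<tau>0 + r * s)"
  define w where "w = 2 * sqrt r - r"
  define N where "N = N_const \<tau>0 \<tau>1 r"
  have s: "0 < s" "s \<le> 1" using \<tau> by (auto simp: s_def)
  have rs: "0 < r * s" using r s by simp
  have q: "0 < q" "q \<le> 1" using rs \<tau> by (auto simp: q_def)
  have "w = 1 - (1 - sqrt r)\<^sup>2" using r by (simp add: w_def power2_eq_square algebra_simps)
  then have w1: "w \<le> 1" by simp
  have "sqrt r \<le> 1" using r by simp
  then have "r \<le> sqrt r" using r by (simp add: real_le_rsqrt power2_eq_square mult_left_le)
  moreover have "0 < sqrt r" using r by simp
  ultimately have w0: "0 < w" unfolding w_def by linarith
  have N0: "0 < N" unfolding N_def N_const_def s_def[symmetric]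
    using \<tau> s r by (auto intro!: divide_pos_pos add_pos_pos add_pos_nonneg mult_pos_pos)
  have N1: "N \<le> \<tau>0 / s" unfolding N_def N_const_def s_def by simp
  have "3 * N * s ^ 3 * (\<tau>0 + q) * w \<le> 3 * (\<tau>0 / s) * s ^ 3 * (\<tau>0 + 1) * 1"
    using N0 N1 s q w0 w1 \<tau> by (intro mult_mono mult_nonneg_nonneg) auto
  also have "\<dots> = 3 * \<tau>0 * (1 + \<tau>0) * s\<^sup>2" using s by (simp add: power3_eq_cube power2_eq_square)
  finally have den: "3 * N * s ^ 3 * (\<tau>0 + q) * w \<le> 3 * \<tau>0 * (1 + \<tau>0) * s\<^sup>2" .
  have "2 * \<tau>0 / s \<le> 8 * \<tau>0 / (3 * s\<^sup>2)"
    using s \<tau> by (simp add: field_simps power2_eq_square)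
  also have "\<dots> = 8 * \<tau>0\<^sup>2 * (1 + \<tau>0) / (3 * \<tau>0 * (1 + \<tau>0) * s\<^sup>2)"
    using \<tau> by (simp add: power2_eq_square)
  also have "\<dots> \<le> 8 * \<tau>0\<^sup>2 * (1 + \<tau>0) / (3 * N * s ^ 3 * (\<tau>0 + q) * w)"
    using N0 s q w0 \<tau> by (intro divide_left_mono[OF den]) (auto intro!: mult_pos_pos add_pos_pos)
  finally show ?thesis
    by (simp add: bias_term_def grad_floor_def N_def w_def q_def s_def)
qed

section \<open>Measurability of the iterates\<close>

text \<open>Projection onto \<open>Rn d\<close>. Losses are controlled on \<open>Rn d\<close> only;
  precomposing with it gives functions on the whole product space, for which Borel measurability can
  be stated.\<close>

definition trunc :: "nat \<Rightarrow> rvec \<Rightarrow> rvec" where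
  "trunc d x = (\<lambda>i. if i < d then x i else 0)"

lemma trunc_in_Rn: "trunc d x \<in> Rn d"
  by (simp add: trunc_def Rn_iff)

lemma trunc_eq: "x \<in> Rn d \<Longrightarrow> trunc d x = x"
  by (auto simp: trunc_def Rn_iff)

lemma continuous_on_trunc: "continuous_on UNIV (trunc d)"
  unfolding trunc_def
proof (rule continuous_on_coordinatewise_then_product)
  fix i show "continuous_on UNIV (\<lambda>x::rvec. if i < d then x i else 0)"
    by (cases "i < d") (auto intro: continuous_on_product_coordinates)
qed

lemma continuous_on_differentiable_Rn:
  assumes "differentiable_Rn d F"
  shows "continuous_on (Rn d) F"
  unfolding continuous_on_eq_continuous_within
  using has_gradient_isCont has_gradient_grad[OF assms] by blast

lemma borel_measurable_differentiable_Rn: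
  assumes "differentiable_Rn d F"
  shows "(\<lambda>x. F (trunc d x)) \<in> borel_measurable borel"
  by (intro borel_measurable_continuous_onI
        continuous_on_compose2[OF continuous_on_differentiable_Rn[OF assms] continuous_on_trunc])
     (use trunc_in_Rn in blast)

text \<open>Individual losses are merely differentiable, so their gradients may be discontinuous.
  Each component is still a pointwise limit of difference quotients along a coordinate direction,
  and these are Borel.\<close>

lemma borel_measurable_grad:
  assumes F: "differentiable_Rn d F"
  shows "(\<lambda>x. grad d F (trunc d x) i) \<in> borel_measurable borel"
proof (cases "i < d")
  case False
  then have "grad d F (trunc d x) i = 0" for x
    using grad_in_Rn[OF F trunc_in_Rn] by (simp add: Rn_iff)
  then show ?thesis by simp
next
  case True
  define e where "e = (\<lambda>j. if j = i then 1 else 0 :: real)"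
  have e: "e \<in> Rn d" using True by (auto simp: e_def Rn_iff)
  define h where "h = (\<lambda>n. inverse (real (Suc n)))"
  show ?thesis
  proof (rule borel_measurable_LIMSEQ_real)
    fix x :: rvec
    have "((\<lambda>s. F (\<lambda>j. trunc d x j + s * e j)) has_real_derivative vdot d (grad d F (trunc d x)) e) (at 0)"
      by (rule has_gradient_line[OF trunc_in_Rn e has_gradient_grad[OF F trunc_in_Rn]])
    moreover have "vdot d (grad d F (trunc d x)) e = grad d F (trunc d x) i"
      using True by (simp add: e_def if_distrib[of "\<lambda>y. _ * y"] cong: if_cong)
    ultimately have "(\<lambda>s. (F (\<lambda>j. trunc d x j + s * e j) - F (trunc d x)) / s) \<midarrow>0\<rightarrow> grad d F (trunc d x) i"
      by (simp add: has_field_derivative_iff)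
    moreover have "filterlim h (at 0) sequentially"
      unfolding filterlim_at using LIMSEQ_inverse_real_of_nat by (simp add: h_def)
    ultimately show "(\<lambda>n. (F (\<lambda>j. trunc d x j + h n * e j) - F (trunc d x)) / h n) \<longlonglongrightarrow> grad d F (trunc d x) i"
      by (rule filterlim_compose)
  next
    fix n
    have "(\<lambda>x. F (trunc d (\<lambda>j. x j + h n * e j))) \<in> borel_measurable borel"
      by (rule measurable_compose[OF _ borel_measurable_differentiable_Rn[OF F]])
         (intro borel_measurable_continuous_onI continuous_on_coordinatewise_then_product
            continuous_intros continuous_on_product_coordinates)
    moreover have "trunc d (\<lambda>j. x j + h n * e j) = (\<lambda>j. trunc d x j + h n * e j)" for x
      using True by (auto simp: trunc_def e_def)
    ultimately have "(\<lambda>x. F (\<lambda>j. trunc d x j + h n * e j)) \<in> borel_measurable borel"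
      by simp
    then show "(\<lambda>x. (F (\<lambda>j. trunc d x j + h n * e j) - F (trunc d x)) / h n) \<in> borel_measurable borel"
      using borel_measurable_differentiable_Rn[OF F] by measurable
  qed
qed

lemma borel_measurable_clip:
  assumes "\<And>i. (\<lambda>x. g x i) \<in> borel_measurable M"
  shows "(\<lambda>x. clip d C r (g x) i) \<in> borel_measurable M"
  unfolding clip_def L2_set_def using assms by measurable

text \<open>The current point and the fresh randomness are separate arguments, so that one step can
  be averaged with the point held fixed.\<close>

definition psac_step ::
    "nat \<Rightarrow> (nat \<Rightarrow> rvec \<Rightarrow> real) \<Rightarrow> nat \<Rightarrow> real \<Rightarrow> real \<Rightarrow> real \<Rightarrow> rvec \<Rightarrow> (nat \<Rightarrow> nat) \<times> rvec \<Rightarrow> rvec" where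
  "psac_step d loss B C r h x p =
     (\<lambda>i. if i < d
          then x i - h / real B * ((\<Sum>j<B. clip d C r (grad d (loss (fst p j)) x) i) + snd p i)
          else 0)"

lemma psac_Suc_step:
  "psac d loss B C r \<eta> x0 \<omega> (Suc t) = psac_step d loss B C r (\<eta> t) (psac d loss B C r \<eta> x0 \<omega> t) (\<omega> t)"
  by (simp add: psac_step_def Let_def case_prod_unfold)

lemma psac_step_in_Rn: "psac_step d loss B C r h x p \<in> Rn d"
  by (simp add: psac_step_def Rn_iff)

lemma psac_in_Rn: "x0 \<in> Rn d \<Longrightarrow> psac d loss B C r \<eta> x0 \<omega> t \<in> Rn d"
  by (cases t) (simp_all only: psac.simps(1) psac_Suc_step psac_step_in_Rn)

text \<open>The iterate at time \<open>t\<close> reads only the randomness of earlier steps, so it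
  ignores coordinate \<open>n\<close> even when \<open>t = n\<close>. This is how independence of
  the next step enters.\<close>

lemma psac_fun_upd: "t \<le> n \<Longrightarrow> psac d loss B C r \<eta> x0 (fun_upd \<omega> n y) t = psac d loss B C r \<eta> x0 \<omega> t"
  by (induction t) (simp_all only: psac.simps(1) psac_Suc_step, simp)

section \<open>Probability spaces of a step and of a run\<close>

abbreviation step_measure :: "nat \<Rightarrow> nat \<Rightarrow> nat \<Rightarrow> real \<Rightarrow> ((nat \<Rightarrow> nat) \<times> rvec) measure" where
  "step_measure d m B s \<equiv> batch_measure m B \<Otimes>\<^sub>M gauss_measure d s"

lemma prob_space_unif_data: "prob_space (unif_data m)"
  by (simp add: unif_data_def measure_pmf.prob_space_axioms)

lemma prob_space_batch: "prob_space (batch_measure m B)"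
  unfolding batch_measure_def by (intro prob_space_PiM prob_space_unif_data)

lemma prob_space_gauss: "s > 0 \<Longrightarrow> prob_space (gauss_measure d s)"
  unfolding gauss_measure_def by (intro prob_space_PiM prob_space_normal_density)

lemma prob_space_step: "s > 0 \<Longrightarrow> prob_space (step_measure d m B s)"
  by (intro prob_space_pair prob_space_batch prob_space_gauss)

lemma prob_space_psac: "C * \<sigma> > 0 \<Longrightarrow> prob_space (psac_measure d m B C \<sigma> T)"
  unfolding psac_measure_def by (intro prob_space_PiM prob_space_step)

lemma measurable_batch_component:
  "j < B \<Longrightarrow> (\<lambda>b. b j) \<in> batch_measure m B \<rightarrow>\<^sub>M count_space UNIV"
proof -
  assume "j < B"
  then have "(\<lambda>b. b j) \<in> batch_measure m B \<rightarrow>\<^sub>M unif_data m"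
    unfolding batch_measure_def by (intro measurable_component_singleton) simp
  moreover have "sets (unif_data m) = sets (count_space UNIV)"
    by (simp add: unif_data_def)
  ultimately show ?thesis using measurable_cong_sets[OF refl] by blast
qed

lemma measurable_gauss_component:
  "i < d \<Longrightarrow> (\<lambda>z. z i) \<in> borel_measurable (gauss_measure d s)"
proof -
  assume "i < d"
  then have "(\<lambda>z. z i) \<in> gauss_measure d s \<rightarrow>\<^sub>M density lborel (\<lambda>u. ennreal (normal_density 0 s u))"
    unfolding gauss_measure_def by (intro measurable_component_singleton) simp
  then show ?thesis by (simp cong: measurable_cong_sets)
qed

lemma measurable_psac_step:
  assumes loss: "\<And>k. differentiable_Rn d (loss k)"
    and X: "X \<in> borel_measurable M" "\<And>\<omega>. X \<omega> \<in> Rn d"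
    and Y: "Y \<in> M \<rightarrow>\<^sub>M step_measure d m B s"
  shows "(\<lambda>\<omega>. psac_step d loss B C r h (X \<omega>) (Y \<omega>)) \<in> borel_measurable M"
proof (rule measurable_coordinatewise_then_product)
  fix i
  have Xi: "(\<lambda>\<omega>. X \<omega> i) \<in> borel_measurable M" for i
    using measurable_compose[OF X(1) measurable_product_coordinates] .
  show "(\<lambda>\<omega>. psac_step d loss B C r h (X \<omega>) (Y \<omega>) i) \<in> borel_measurable M"
  proof (cases "i < d")
    case True
    have "(\<lambda>\<omega>. snd (Y \<omega>) i) \<in> borel_measurable M"
      using measurable_compose[OF measurable_compose[OF Y measurable_snd] measurable_gauss_component[OF True]] .
    moreover have "(\<lambda>\<omega>. \<Sum>j<B. clip d C r (grad d (loss (fst (Y \<omega>) j)) (X \<omega>)) i) \<in> borel_measurable M"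
    proof (intro borel_measurable_sum borel_measurable_clip)
      fix j i assume "j \<in> {..<B}"
      then have "(\<lambda>\<omega>. fst (Y \<omega>) j) \<in> M \<rightarrow>\<^sub>M count_space UNIV"
        by (intro measurable_compose[OF measurable_compose[OF Y measurable_fst] measurable_batch_component]) simp
      moreover have "(\<lambda>\<omega>. grad d (loss k) (X \<omega>) i) \<in> borel_measurable M" for k
        using measurable_compose[OF X(1) borel_measurable_grad[OF loss, of k i]] trunc_eq[OF X(2)] by simp
      \<comment> \<open>The sampled index ranges over a countable set, so measurability for each
        fixed index suffices.\<close>
      ultimately show "(\<lambda>\<omega>. grad d (loss (fst (Y \<omega>) j)) (X \<omega>) i) \<in> borel_measurable M"
        by (rule measurable_compose_countable[rotated])
    qed
    ultimately show ?thesis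
      using True Xi[of i] by (simp add: psac_step_def)
  qed (simp add: psac_step_def)
qed

lemma measurable_psac:
  assumes loss: "\<And>k. differentiable_Rn d (loss k)" and x0: "x0 \<in> Rn d" and t: "t \<le> n"
  shows "(\<lambda>\<omega>. psac d loss B C r \<eta> x0 \<omega> t) \<in> borel_measurable (Pi\<^sub>M {..<n} (\<lambda>_. step_measure d m B s))"
  using t
proof (induction t)
  case (Suc t)
  have "(\<lambda>\<omega>. \<omega> t) \<in> Pi\<^sub>M {..<n} (\<lambda>_. step_measure d m B s) \<rightarrow>\<^sub>M step_measure d m B s"
    using Suc.prems by (intro measurable_component_singleton) simp
  then show ?case
    unfolding psac_Suc_step using Suc
    by (intro measurable_psac_step[where m = m and s = s] loss psac_in_Rn[OF x0]) auto
qed simp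

section \<open>Gaussian noise\<close>

lemma gauss_moments:
  assumes s: "s > 0" and i: "i < d"
  shows "integrable (gauss_measure d s) (\<lambda>z. z i)"
    and "(\<integral>z. z i \<partial>gauss_measure d s) = 0"
    and "integrable (gauss_measure d s) (\<lambda>z. (z i)\<^sup>2)"
    and "(\<integral>z. (z i)\<^sup>2 \<partial>gauss_measure d s) = s\<^sup>2"
proof -
  let ?N = "density lborel (\<lambda>u. ennreal (normal_density 0 s u))"
  have N: "prob_space ?N" by (rule prob_space_normal_density[OF s])
  have D: "distr (gauss_measure d s) ?N (\<lambda>z. z i) = ?N"
    unfolding gauss_measure_def using i N by (intro distr_PiM_component) auto
  have meas: "(\<lambda>z. z i) \<in> gauss_measure d s \<rightarrow>\<^sub>M ?N"
    unfolding gauss_measure_def using i by (intro measurable_component_singleton) simp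
  have int: "integrable (gauss_measure d s) (\<lambda>z. f (z i)) \<longleftrightarrow> integrable ?N f"
    "(\<integral>z. f (z i) \<partial>gauss_measure d s) = (\<integral>u. f u \<partial>?N)" if "f \<in> borel_measurable borel" for f :: "real \<Rightarrow> real"
    using integrable_distr_eq[OF meas, of f] integral_distr[OF meas, of f] that by (simp_all add: D)
  have dens: "integrable ?N f \<longleftrightarrow> integrable lborel (\<lambda>u. normal_density 0 s u * f u)"
    "(\<integral>u. f u \<partial>?N) = (\<integral>u. normal_density 0 s u * f u \<partial>lborel)" if "f \<in> borel_measurable borel" for f :: "real \<Rightarrow> real"
    using that by (simp_all add: integrable_density integral_density)
  show "integrable (gauss_measure d s) (\<lambda>z. z i)"
    using int(1)[of "\<lambda>u. u"] dens(1)[of "\<lambda>u. u"] integrable_normal_moment_nz_1[OF s, of 0] by simp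
  show "(\<integral>z. z i \<partial>gauss_measure d s) = 0"
    using int(2)[of "\<lambda>u. u"] dens(2)[of "\<lambda>u. u"] integral_normal_moment_nz_1[OF s, of 0] by simp
  show "integrable (gauss_measure d s) (\<lambda>z. (z i)\<^sup>2)"
    using int(1)[of "\<lambda>u. u\<^sup>2"] dens(1)[of "\<lambda>u. u\<^sup>2"] integrable_normal_moment[OF s, of 0 2] by simp
  show "(\<integral>z. (z i)\<^sup>2 \<partial>gauss_measure d s) = s\<^sup>2"
    using int(2)[of "\<lambda>u. u\<^sup>2"] dens(2)[of "\<lambda>u. u\<^sup>2"] integral_normal_moment_even[OF s, of 0 1]
    by (simp add: fact_numeral)
qed

text \<open>The shape of the one-step bound on the objective as a function of the noise: the linear
  terms average to zero and each square contributes the variance.\<close>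

lemma gauss_quadratic:
  fixes a c :: real and p :: rvec and d :: nat
  assumes s: "s > 0"
  defines "q \<equiv> \<lambda>z::rvec. a + (\<Sum>i<d. p i * z i + c * (z i)\<^sup>2)"
  shows "integrable (gauss_measure d s) q" and "(\<integral>z. q z \<partial>gauss_measure d s) = a + real d * c * s\<^sup>2"
proof -
  interpret prob_space "gauss_measure d s" by (rule prob_space_gauss[OF s])
  have summand: "integrable (gauss_measure d s) (\<lambda>z. p i * z i + c * (z i)\<^sup>2)"
    "(\<integral>z. p i * z i + c * (z i)\<^sup>2 \<partial>gauss_measure d s) = c * s\<^sup>2" if "i < d" for i
    using gauss_moments[OF s that] by simp_all
  then have sum: "integrable (gauss_measure d s) (\<lambda>z. \<Sum>i<d. p i * z i + c * (z i)\<^sup>2)"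
    by (intro Bochner_Integration.integrable_sum) simp
  then show "integrable (gauss_measure d s) q"
    unfolding q_def by simp
  have "(\<integral>z. (\<Sum>i<d. p i * z i + c * (z i)\<^sup>2) \<partial>gauss_measure d s) = (\<Sum>i<d. c * s\<^sup>2)"
    using summand by (subst Bochner_Integration.integral_sum) simp_all
  then show "(\<integral>z. q z \<partial>gauss_measure d s) = a + real d * c * s\<^sup>2"
    unfolding q_def using sum by (simp add: prob_space)
qed

section \<open>The stopped descent\<close>

text \<open>\<open>diff\<close> and \<open>dev\<close> range over all indices, which makes every
  iterate measurable. \<open>\<eta>_small\<close> lets the gradient-dependent part of the curvature
  term use at most half of the first-order decrease.\<close>

locale psac_descent =
  fixes d m B :: nat and loss :: "nat \<Rightarrow> rvec \<Rightarrow> real" and x0 :: rvec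
    and L0 L1 \<tau>0 \<tau>1 r C \<sigma> \<eta> :: real
  assumes B: "B \<ge> 1" and \<sigma>: "\<sigma> > 0" and L: "L0 > 0" "L1 \<ge> 0"
    and \<tau>: "\<tau>0 > 0" "0 \<le> \<tau>1" "\<tau>1 < 1" and r: "0 < r" "r \<le> 1" and C: "C > 0"
    and diff: "\<And>k. differentiable_Rn d (loss k)"
    and smooth: "gen_smooth d L0 L1 (avg_loss m loss)"
    and dev: "\<And>k x. x \<in> Rn d \<Longrightarrow> vnorm d (grad d (loss k) x - grad d (avg_loss m loss) x)
        \<le> \<tau>0 + \<tau>1 * vnorm d (grad d (avg_loss m loss) x)"
    and x0: "x0 \<in> Rn d"
    and bdd: "bdd_below (avg_loss m loss ` Rn d)"
    and \<eta>: "\<eta> > 0"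
    and \<eta>_small: "\<eta> * C * L1 * (1 + real d * \<sigma>\<^sup>2 / (real B)\<^sup>2) \<le> clip_rate \<tau>0 \<tau>1"
begin

abbreviation "F \<equiv> avg_loss m loss"

text \<open>Subtracting the infimum makes the objective nonnegative on \<open>Rn d\<close>, so
  expectations can be taken as nonnegative integrals, without integrability conditions.\<close>

definition "V x = F x - (INF y\<in>Rn d. F y)"

abbreviation "u x \<equiv> vnorm d (grad d F x)"

abbreviation "step \<equiv> psac_step d loss B C r \<eta>"

abbreviation "iter \<omega> t \<equiv> psac d loss B C r (\<lambda>_. \<eta>) x0 \<omega> t"

text \<open>\<open>gain\<close> is half of the guaranteed first-order decrease per unit of gradient
  norm; the other half pays for the \<open>L1\<close> part of the curvature. \<open>loss_inc\<close>
  is the remaining \<open>L0\<close> part, from the clipped gradients and the noise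
  variance.\<close>

definition "gain = \<eta> * C * clip_rate \<tau>0 \<tau>1 / 2"

definition "loss_inc = L0 / 2 * \<eta>\<^sup>2 * C\<^sup>2 * (1 + real d * \<sigma>\<^sup>2 / (real B)\<^sup>2)"

lemma F_diff: "differentiable_Rn d F"
  using diff by (rule differentiable_avg_loss)

lemma V_nonneg: "x \<in> Rn d \<Longrightarrow> V x \<ge> 0"
  unfolding V_def using cINF_lower[OF bdd] by simp

lemma gain_pos: "gain > 0"
  unfolding gain_def using \<eta> C clip_rate_pos[OF \<tau>(1,3)] by simp

lemma loss_inc_nonneg: "loss_inc \<ge> 0"
  unfolding loss_inc_def using L by simp

text \<open>The descent inequality is applied to the whole step: alignment is summed over the batch
  and the clipped sum has norm at most \<open>B * C\<close>. Only existence of \<open>p\<close> is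
  stated, since linear noise terms have mean zero; \<open>p\<close> may depend on the batch but not
  on \<open>z\<close>.\<close>

lemma V_step_le:
  fixes b :: "nat \<Rightarrow> nat"
  assumes x: "x \<in> Rn d" and big: "grad_floor \<tau>0 \<tau>1 \<le> u x"
  defines "M \<equiv> L0 + L1 * u x"
  shows "\<exists>p. \<forall>z. V (step x (b, z)) \<le> V x - \<eta> * C * clip_rate \<tau>0 \<tau>1 * u x + M / 2 * \<eta>\<^sup>2 * C\<^sup>2
      + (\<Sum>i<d. p i * z i + M / 2 * (\<eta> / real B)\<^sup>2 * (z i)\<^sup>2)"
proof -
  define h where "h = \<eta> / real B"
  define S where "S = (\<lambda>i. \<Sum>j<B. clip d C r (grad d (loss (b j)) x) i)"
  define g where "g = grad d F x"
  define c where "c = M / 2 * h\<^sup>2"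
  \<comment> \<open>The first part comes from the linear term, the second is the cross term of the
    squared norm of \<open>S + z\<close>.\<close>
  define p where "p = (\<lambda>i. - h * g i + 2 * c * S i)"
  have M: "M > 0" unfolding M_def using L by (simp add: add_pos_nonneg)
  have S_norm: "vnorm d S \<le> B * C"
    using order_trans[OF vnorm_sum_le sum_bounded_above[of "{..<B}" _ C]] vnorm_clip_le[OF C r(1)]
    unfolding S_def by (simp add: mult.commute)
  have S_dot: "h * vdot d g S \<ge> \<eta> * C * clip_rate \<tau>0 \<tau>1 * u x"
  proof -
    have "vdot d g S = (\<Sum>j<B. vdot d g (clip d C r (grad d (loss (b j)) x)))"
      unfolding S_def by (simp add: sum_distrib_left sum.swap[of _ "{..<B}"])
    also have "\<dots> \<ge> (\<Sum>j<B. C * clip_rate \<tau>0 \<tau>1 * u x)"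
      unfolding g_def by (intro sum_mono vdot_clip_ge[OF \<tau> r C dev[OF x] big])
    finally have "real B * (C * clip_rate \<tau>0 \<tau>1 * u x) \<le> vdot d g S" by simp
    then have "h * (real B * (C * clip_rate \<tau>0 \<tau>1 * u x)) \<le> h * vdot d g S"
      using \<eta> by (intro mult_left_mono) (auto simp: h_def)
    then show ?thesis using B by (simp add: h_def)
  qed
  have "V (step x (b, z)) \<le> V x - \<eta> * C * clip_rate \<tau>0 \<tau>1 * u x + M / 2 * \<eta>\<^sup>2 * C\<^sup>2
      + (\<Sum>i<d. p i * z i + c * (z i)\<^sup>2)" for z
  proof -
    define w where "w = (\<lambda>i. if i < d then - h * (S i + z i) else 0)"
    have w: "w \<in> Rn d" by (simp add: w_def Rn_iff)
    have "step x (b, z) = (\<lambda>i. x i + w i)"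
      using x by (auto simp: psac_step_def w_def h_def S_def Rn_iff)
    then have "V (step x (b, z)) \<le> V x + vdot d g w + M / 2 * (vnorm d w)\<^sup>2"
      using gen_smooth_descent[OF F_diff smooth _ _ x w] L unfolding V_def g_def M_def by simp
    also have "vdot d g w = - (h * vdot d g S) + (\<Sum>i<d. - h * g i * z i)"
    proof -
      have "vdot d g w = (\<Sum>i<d. - (h * (g i * S i)) + - h * g i * z i)"
        by (rule sum.cong) (auto simp: w_def algebra_simps)
      then show ?thesis by (simp only: sum.distrib sum_negf sum_distrib_left)
    qed
    also have "M / 2 * (vnorm d w)\<^sup>2 = c * (vnorm d S)\<^sup>2 + (\<Sum>i<d. 2 * c * S i * z i + c * (z i)\<^sup>2)"
    proof -
      have "(vnorm d w)\<^sup>2 = (\<Sum>i<d. h\<^sup>2 * ((S i)\<^sup>2 + (2 * S i * z i + (z i)\<^sup>2)))"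
        unfolding vnorm_power2 by (rule sum.cong) (auto simp: w_def power2_eq_square algebra_simps)
      then have "M / 2 * (vnorm d w)\<^sup>2 = (\<Sum>i<d. c * (S i)\<^sup>2 + (2 * c * S i * z i + c * (z i)\<^sup>2))"
        by (simp add: sum_distrib_left c_def algebra_simps)
      then show ?thesis unfolding vnorm_power2 by (simp only: sum.distrib sum_distrib_left)
    qed
    also have "c * (vnorm d S)\<^sup>2 \<le> c * (B * C)\<^sup>2"
      using S_norm M by (intro mult_left_mono power_mono) (auto simp: c_def)
    also have "c * (B * C)\<^sup>2 = M / 2 * \<eta>\<^sup>2 * C\<^sup>2"
      using B by (simp add: c_def h_def power_divide power_mult_distrib)
    finally have "V (step x (b, z)) \<le> V x + (- (h * vdot d g S) + (\<Sum>i<d. - h * g i * z i))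
        + (M / 2 * \<eta>\<^sup>2 * C\<^sup>2 + (\<Sum>i<d. 2 * c * S i * z i + c * (z i)\<^sup>2))" by simp
    moreover have "(\<Sum>i<d. p i * z i + c * (z i)\<^sup>2)
        = (\<Sum>i<d. - h * g i * z i) + (\<Sum>i<d. 2 * c * S i * z i + c * (z i)\<^sup>2)"
      unfolding sum.distrib[symmetric] by (rule sum.cong) (auto simp: p_def algebra_simps)
    ultimately show ?thesis using S_dot by linarith
  qed
  then show ?thesis unfolding c_def h_def by blast
qed

lemma measurable_V: "X \<in> borel_measurable M \<Longrightarrow> (\<And>\<omega>. X \<omega> \<in> Rn d) \<Longrightarrow> (\<lambda>\<omega>. V (X \<omega>)) \<in> borel_measurable M"
  using measurable_compose[OF _ borel_measurable_differentiable_Rn[OF F_diff], of X M]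
  by (simp add: V_def trunc_eq)

lemma measurable_u: "X \<in> borel_measurable M \<Longrightarrow> (\<And>\<omega>. X \<omega> \<in> Rn d) \<Longrightarrow> (\<lambda>\<omega>. u (X \<omega>)) \<in> borel_measurable M"
proof -
  assume X: "X \<in> borel_measurable M" "\<And>\<omega>. X \<omega> \<in> Rn d"
  have "(\<lambda>\<omega>. grad d F (X \<omega>) i) \<in> borel_measurable M" for i
    using measurable_compose[OF X(1) borel_measurable_grad[OF F_diff, of i]] by (simp add: trunc_eq[OF X(2)])
  then show ?thesis unfolding L2_set_def by measurable
qed

text \<open>The drift inequality. The noise is averaged first with the batch fixed; the resulting
  bound \<open>R\<close> is the same for every batch.\<close>

lemma nn_integral_V_step:
  assumes x: "x \<in> Rn d" and big: "grad_floor \<tau>0 \<tau>1 \<le> u x"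
  shows "ennreal (gain * u x) + (\<integral>\<^sup>+p. ennreal (V (step x p)) \<partial>step_measure d m B (C * \<sigma>))
    \<le> ennreal (V x + loss_inc)"
proof -
  define M where "M = L0 + L1 * u x"
  define D where "D = real d * \<sigma>\<^sup>2 / (real B)\<^sup>2"
  define R where "R = V x - \<eta> * C * clip_rate \<tau>0 \<tau>1 * u x + M / 2 * \<eta>\<^sup>2 * C\<^sup>2 * (1 + D)"
  have s: "C * \<sigma> > 0" using C \<sigma> by simp
  interpret G: prob_space "gauss_measure d (C * \<sigma>)" by (rule prob_space_gauss[OF s])
  interpret Bt: prob_space "batch_measure m B" by (rule prob_space_batch)
  have meas: "(\<lambda>p. V (step x p)) \<in> borel_measurable (step_measure d m B (C * \<sigma>))"
    by (intro measurable_V measurable_psac_step[where m = m and s = "C * \<sigma>"] diff psac_step_in_Rn)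
       (use x in auto)
  have inner: "(\<integral>\<^sup>+z. ennreal (V (step x (b, z))) \<partial>gauss_measure d (C * \<sigma>)) \<le> ennreal R \<and> 0 \<le> R" for b
  proof -
    define A where "A = V x - \<eta> * C * clip_rate \<tau>0 \<tau>1 * u x + M / 2 * \<eta>\<^sup>2 * C\<^sup>2"
    define c where "c = M / 2 * (\<eta> / real B)\<^sup>2"
    obtain p where p: "\<And>z. V (step x (b, z)) \<le> A + (\<Sum>i<d. p i * z i + c * (z i)\<^sup>2)"
      using V_step_le[OF x big, of b] unfolding A_def M_def c_def by blast
    let ?q = "\<lambda>z. A + (\<Sum>i<d. p i * z i + c * (z i)\<^sup>2)"
    \<comment> \<open>The quadratic dominates the nonnegative \<open>V\<close>, so its nonnegative
      integral equals its Lebesgue integral.\<close>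
    have q0: "0 \<le> ?q z" for z
      using p[of z] V_nonneg[OF psac_step_in_Rn] order_trans by blast
    have int: "(\<integral>z. ?q z \<partial>gauss_measure d (C * \<sigma>)) = R"
      unfolding gauss_quadratic(2)[OF s] using B
      by (simp add: R_def A_def c_def D_def power_mult_distrib power_divide algebra_simps)
    have "(\<integral>\<^sup>+z. ennreal (V (step x (b, z))) \<partial>gauss_measure d (C * \<sigma>))
        \<le> (\<integral>\<^sup>+z. ennreal (?q z) \<partial>gauss_measure d (C * \<sigma>))"
      using p by (intro nn_integral_mono ennreal_leI)
    also have "\<dots> = ennreal R"
      using nn_integral_eq_integral[OF gauss_quadratic(1)[OF s]] q0 int by simp
    finally show ?thesis using int Bochner_Integration.integral_nonneg[of "gauss_measure d (C * \<sigma>)" ?q, OF q0] by simp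
  qed
  have "(\<integral>\<^sup>+p. ennreal (V (step x p)) \<partial>step_measure d m B (C * \<sigma>))
      = (\<integral>\<^sup>+b. \<integral>\<^sup>+z. ennreal (V (step x (b, z))) \<partial>gauss_measure d (C * \<sigma>) \<partial>batch_measure m B)"
    using meas by (intro G.nn_integral_fst[symmetric]) simp
  also have "\<dots> \<le> (\<integral>\<^sup>+b. ennreal R \<partial>batch_measure m B)"
    using inner by (intro nn_integral_mono) blast
  also have "\<dots> = ennreal R" by (simp add: Bt.emeasure_space_1)
  finally have "ennreal (gain * u x) + (\<integral>\<^sup>+p. ennreal (V (step x p)) \<partial>step_measure d m B (C * \<sigma>))
      \<le> ennreal (gain * u x) + ennreal R" by (rule add_left_mono)
  also have "\<dots> = ennreal (gain * u x + R)"
    using inner gain_pos by (intro ennreal_plus[symmetric]) auto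
  also have "\<dots> \<le> ennreal (V x + loss_inc)"
  proof (rule ennreal_leI)
    \<comment> \<open>The step-size condition is multiplied by \<open>\<eta> * C * u x / 2\<close>,
      which turns its right-hand side into \<open>gain * u x\<close>.\<close>
    have "\<eta> * C * L1 * (1 + D) * (\<eta> * C * u x / 2) \<le> clip_rate \<tau>0 \<tau>1 * (\<eta> * C * u x / 2)"
      using \<eta>_small \<eta> C by (intro mult_right_mono) (auto simp: D_def)
    then have "L1 * u x / 2 * \<eta>\<^sup>2 * C\<^sup>2 * (1 + D) \<le> gain * u x"
      by (simp add: gain_def power2_eq_square mult_ac)
    moreover have "R = V x - 2 * (gain * u x) + loss_inc + L1 * u x / 2 * \<eta>\<^sup>2 * C\<^sup>2 * (1 + D)"
      by (simp add: R_def M_def loss_inc_def gain_def D_def algebra_simps add_divide_distrib)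
    ultimately show "gain * u x + R \<le> V x + loss_inc" by linarith
  qed
  finally show ?thesis .
qed

text \<open>Below the floor the clipped gradient may point uphill, so the descent is only summed up to the first
  visit there; \<open>active \<omega> t\<close> depends on the gradients at times strictly before \<open>t\<close>.\<close>

definition active :: "(nat \<Rightarrow> (nat \<Rightarrow> nat) \<times> rvec) \<Rightarrow> nat \<Rightarrow> bool" where
  "active \<omega> t \<longleftrightarrow> (\<forall>s<t. grad_floor \<tau>0 \<tau>1 \<le> u (iter \<omega> s))"

text \<open>The weight is taken at \<open>Suc t\<close>, so the term at time \<open>t\<close> counts
  only if its own gradient norm is above the floor too, as the drift inequality requires.\<close>

definition stopped_sum :: "(nat \<Rightarrow> (nat \<Rightarrow> nat) \<times> rvec) \<Rightarrow> nat \<Rightarrow> real" where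
  "stopped_sum \<omega> n = (\<Sum>t<n. of_bool (active \<omega> (Suc t)) * u (iter \<omega> t))"

abbreviation "runs n \<equiv> Pi\<^sub>M {..<n} (\<lambda>_. step_measure d m B (C * \<sigma>))"

lemma stopped_sum_nonneg: "stopped_sum \<omega> n \<ge> 0"
  unfolding stopped_sum_def by (intro sum_nonneg) simp

lemma stopped_sum_Suc:
  "stopped_sum \<omega> (Suc n) = stopped_sum \<omega> n + of_bool (active \<omega> (Suc n)) * u (iter \<omega> n)"
  by (simp add: stopped_sum_def)

lemma active_Suc: "active \<omega> (Suc n) \<longleftrightarrow> active \<omega> n \<and> grad_floor \<tau>0 \<tau>1 \<le> u (iter \<omega> n)"
  unfolding active_def by (auto simp: less_Suc_eq)

lemma active_upd: "t \<le> Suc n \<Longrightarrow> active (fun_upd \<omega> n y) t = active \<omega> t"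
  unfolding active_def by (simp add: psac_fun_upd)

lemma stopped_sum_upd: "stopped_sum (fun_upd \<omega> n y) n = stopped_sum \<omega> n"
  unfolding stopped_sum_def by (simp add: active_upd psac_fun_upd)

lemma iter_in_Rn: "iter \<omega> t \<in> Rn d"
  by (rule psac_in_Rn[OF x0])

lemma measurable_u_iter: "t \<le> n \<Longrightarrow> (\<lambda>\<omega>. u (iter \<omega> t)) \<in> borel_measurable (runs n)"
  by (intro measurable_u measurable_psac diff x0 iter_in_Rn)

lemma measurable_V_iter: "t \<le> n \<Longrightarrow> (\<lambda>\<omega>. V (iter \<omega> t)) \<in> borel_measurable (runs n)"
  by (intro measurable_V measurable_psac diff x0 iter_in_Rn)

text \<open>A run of \<open>n\<close> steps determines the iterates up to index \<open>n\<close>,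
  hence activity up to \<open>Suc n\<close>.\<close>

lemma measurable_active: "t \<le> Suc n \<Longrightarrow> Measurable.pred (runs n) (\<lambda>\<omega>. active \<omega> t)"
proof (induction t)
  case 0
  then show ?case by (simp add: active_def)
next
  case (Suc t)
  then have [measurable]: "(\<lambda>\<omega>. u (iter \<omega> t)) \<in> borel_measurable (runs n)"
      "Measurable.pred (runs n) (\<lambda>\<omega>. active \<omega> t)"
    by (auto intro: measurable_u_iter)
  show ?case unfolding active_Suc by measurable
qed

lemma measurable_stopped_sum: "t \<le> Suc n \<Longrightarrow> (\<lambda>\<omega>. stopped_sum \<omega> t) \<in> borel_measurable (runs n)"
  unfolding stopped_sum_def
proof (intro borel_measurable_sum borel_measurable_times, goal_cases)
  case (1 s)
  then have [measurable]: "Measurable.pred (runs n) (\<lambda>\<omega>. active \<omega> (Suc s))"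
    by (intro measurable_active) simp
  show ?case by measurable
next
  case (2 s)
  then show ?case by (intro measurable_u_iter) simp
qed

text \<open>The integrand is a supermartingale up to an increase of \<open>loss_inc\<close> per
  step. The induction integrates out the last coordinate with the earlier ones fixed and applies the
  drift inequality while the run is active.\<close>

lemma nn_integral_stopped:
  "(\<integral>\<^sup>+\<omega>. ennreal (gain * stopped_sum \<omega> n + of_bool (active \<omega> n) * V (iter \<omega> n)) \<partial>runs n)
    \<le> ennreal (V x0 + real n * loss_inc)"
proof (induction n)
  case 0
  show ?case by (simp add: stopped_sum_def active_def PiM_empty emeasure_count_space)
next
  case (Suc n)
  let ?\<mu> = "step_measure d m B (C * \<sigma>)"
  let ?h = "\<lambda>n \<omega>. gain * stopped_sum \<omega> n + of_bool (active \<omega> n) * V (iter \<omega> n)"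
  have s: "C * \<sigma> > 0" using C \<sigma> by simp
  interpret \<mu>: prob_space ?\<mu> by (rule prob_space_step[OF s])
  interpret product_prob_space "\<lambda>_::nat. ?\<mu>" by unfold_locales
  interpret Q: prob_space "runs n" by (intro prob_space_PiM \<mu>.prob_space_axioms)
  have h_meas: "?h n \<in> borel_measurable (runs n)" for n
    using measurable_stopped_sum[of n n] measurable_active[of n n] measurable_V_iter[of n n] by measurable
  have h_nonneg: "?h n \<omega> \<ge> 0" for n \<omega>
    using gain_pos stopped_sum_nonneg V_nonneg[OF iter_in_Rn] by simp
  have inner: "(\<integral>\<^sup>+y. ennreal (?h (Suc n) (fun_upd \<omega> n y)) \<partial>?\<mu>) \<le> ennreal (?h n \<omega> + loss_inc)" for \<omega>
  proof (cases "active \<omega> (Suc n)")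
    \<comment> \<open>Once the current or an earlier norm is below the floor, the sum freezes and
      the \<open>V\<close> term vanishes, which can only decrease the integrand.\<close>
    case False
    then have "(\<integral>\<^sup>+y. ennreal (?h (Suc n) (fun_upd \<omega> n y)) \<partial>?\<mu>) = ennreal (gain * stopped_sum \<omega> n)"
      by (simp add: stopped_sum_Suc active_upd stopped_sum_upd \<mu>.emeasure_space_1)
    also have "\<dots> \<le> ennreal (?h n \<omega> + loss_inc)"
      using V_nonneg[OF iter_in_Rn] loss_inc_nonneg by (intro ennreal_leI) simp
    finally show ?thesis .
  next
    case True
    let ?x = "iter \<omega> n" and ?S = "gain * stopped_sum \<omega> n"
    have big: "grad_floor \<tau>0 \<tau>1 \<le> u ?x" and act: "active \<omega> n"
      using True by (auto simp: active_Suc)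
    have S0: "0 \<le> ?S" using gain_pos stopped_sum_nonneg by simp
    have g0: "0 \<le> gain * u ?x" using gain_pos by simp
    have meas: "(\<lambda>p. V (step ?x p)) \<in> borel_measurable ?\<mu>"
      by (intro measurable_V measurable_psac_step[where m = m and s = "C * \<sigma>"] diff psac_step_in_Rn)
         (use iter_in_Rn in auto)
    have "(\<integral>\<^sup>+y. ennreal (?h (Suc n) (fun_upd \<omega> n y)) \<partial>?\<mu>)
        = (\<integral>\<^sup>+y. ennreal (?S + gain * u ?x) + ennreal (V (step ?x y)) \<partial>?\<mu>)"
      using True S0 g0 V_nonneg[OF psac_step_in_Rn]
      by (intro nn_integral_cong)
         (simp add: stopped_sum_Suc active_upd stopped_sum_upd psac_Suc_step psac_fun_upd
            distrib_left ennreal_plus[symmetric] del: ennreal_plus psac.simps)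
    also have "\<dots> = ennreal ?S + (ennreal (gain * u ?x) + (\<integral>\<^sup>+y. ennreal (V (step ?x y)) \<partial>?\<mu>))"
      using meas S0 g0 by (subst nn_integral_add) (auto simp: \<mu>.emeasure_space_1 add.assoc)
    also have "\<dots> \<le> ennreal ?S + ennreal (V ?x + loss_inc)"
      by (intro add_left_mono nn_integral_V_step iter_in_Rn big)
    also have "\<dots> = ennreal (?h n \<omega> + loss_inc)"
      using S0 V_nonneg[OF iter_in_Rn] loss_inc_nonneg act
      by (subst ennreal_plus[symmetric]) (auto simp: add.assoc)
    finally show ?thesis .
  qed
  have "(\<integral>\<^sup>+\<omega>. ennreal (?h (Suc n) \<omega>) \<partial>runs (Suc n))
      = (\<integral>\<^sup>+\<omega>. \<integral>\<^sup>+y. ennreal (?h (Suc n) (fun_upd \<omega> n y)) \<partial>?\<mu> \<partial>runs n)"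
    using h_meas[of "Suc n"] unfolding lessThan_Suc by (intro product_nn_integral_insert) auto
  also have "\<dots> \<le> (\<integral>\<^sup>+\<omega>. ennreal (?h n \<omega> + loss_inc) \<partial>runs n)"
    by (intro nn_integral_mono inner)
  also have "\<dots> = (\<integral>\<^sup>+\<omega>. ennreal (?h n \<omega>) + ennreal loss_inc \<partial>runs n)"
    using h_nonneg loss_inc_nonneg by (intro nn_integral_cong ennreal_plus)
  also have "\<dots> = (\<integral>\<^sup>+\<omega>. ennreal (?h n \<omega>) \<partial>runs n) + ennreal loss_inc"
    using h_meas[of n] by (subst nn_integral_add) (auto simp: Q.emeasure_space_1)
  also have "\<dots> \<le> ennreal (V x0 + real n * loss_inc) + ennreal loss_inc"
    by (intro add_right_mono Suc.IH)
  also have "\<dots> = ennreal (V x0 + real (Suc n) * loss_inc)"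
    using V_nonneg[OF x0] loss_inc_nonneg by (subst ennreal_plus[symmetric]) (auto simp: algebra_simps)
  finally show ?case .
qed

text \<open>Pathwise: either some iterate lies below the floor, or the stopped sum is the full sum
  and the minimum is at most its average.\<close>

lemma Min_le_stopped_sum:
  assumes T: "T \<ge> 1"
  shows "Min ((\<lambda>t. u (iter \<omega> t)) ` {..<T}) \<le> grad_floor \<tau>0 \<tau>1 + stopped_sum \<omega> T / real T"
proof (cases "active \<omega> T")
  case True
  let ?m = "Min ((\<lambda>t. u (iter \<omega> t)) ` {..<T})"
  have "active \<omega> (Suc t)" if "t < T" for t
    using True that unfolding active_def by simp
  then have "stopped_sum \<omega> T = (\<Sum>t<T. u (iter \<omega> t))"
    unfolding stopped_sum_def by simp
  moreover have "(\<Sum>t<T. ?m) \<le> (\<Sum>t<T. u (iter \<omega> t))"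
    by (intro sum_mono Min_le) auto
  ultimately have "?m \<le> stopped_sum \<omega> T / real T"
    using T by (simp add: field_simps)
  moreover have "0 \<le> grad_floor \<tau>0 \<tau>1" using \<tau> by (simp add: grad_floor_def)
  ultimately show ?thesis by simp
next
  case False
  then obtain t where t: "t < T" "u (iter \<omega> t) < grad_floor \<tau>0 \<tau>1"
    unfolding active_def by (auto simp: not_le)
  have "Min ((\<lambda>t. u (iter \<omega> t)) ` {..<T}) \<le> u (iter \<omega> t)"
    using t by (intro Min_le) auto
  also have "\<dots> \<le> grad_floor \<tau>0 \<tau>1 + stopped_sum \<omega> T / real T"
    using t stopped_sum_nonneg[of \<omega> T] by (intro add_increasing2) auto
  finally show ?thesis .
qed

lemma nn_integral_Min_le:
  assumes T: "T \<ge> 1"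
  shows "(\<integral>\<^sup>+\<omega>. ennreal (Min ((\<lambda>t. u (iter \<omega> t)) ` {..<T})) \<partial>psac_measure d m B C \<sigma> T)
    \<le> ennreal (grad_floor \<tau>0 \<tau>1 + (V x0 + real T * loss_inc) / (gain * real T))"
proof -
  let ?G = "grad_floor \<tau>0 \<tau>1" and ?c = "1 / (gain * real T)"
  interpret Q: prob_space "runs T"
    using C \<sigma> by (intro prob_space_PiM prob_space_step) simp
  have G0: "0 \<le> ?G" using \<tau> by (simp add: grad_floor_def)
  have c0: "0 \<le> ?c" using gain_pos by simp
  have "(\<integral>\<^sup>+\<omega>. ennreal (Min ((\<lambda>t. u (iter \<omega> t)) ` {..<T})) \<partial>runs T)
      \<le> (\<integral>\<^sup>+\<omega>. ennreal ?G + ennreal ?c * ennreal (gain * stopped_sum \<omega> T) \<partial>runs T)"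
  proof (intro nn_integral_mono)
    fix \<omega>
    have "ennreal (Min ((\<lambda>t. u (iter \<omega> t)) ` {..<T})) \<le> ennreal (?G + ?c * (gain * stopped_sum \<omega> T))"
      using Min_le_stopped_sum[OF T, of \<omega>] gain_pos by (intro ennreal_leI) simp
    then show "ennreal (Min ((\<lambda>t. u (iter \<omega> t)) ` {..<T}))
        \<le> ennreal ?G + ennreal ?c * ennreal (gain * stopped_sum \<omega> T)"
      using G0 c0 gain_pos stopped_sum_nonneg[of \<omega> T]
      by (subst ennreal_mult[symmetric], simp, simp, subst ennreal_plus[symmetric]) auto
  qed
  also have "\<dots> = ennreal ?G + ennreal ?c * (\<integral>\<^sup>+\<omega>. ennreal (gain * stopped_sum \<omega> T) \<partial>runs T)"
    using measurable_stopped_sum[of T T] by (simp add: nn_integral_add nn_integral_cmult Q.emeasure_space_1)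
  also have "\<dots> \<le> ennreal ?G + ennreal ?c * ennreal (V x0 + real T * loss_inc)"
  proof (intro add_left_mono mult_left_mono order_trans[OF nn_integral_mono nn_integral_stopped])
    show "ennreal (gain * stopped_sum \<omega> T)
        \<le> ennreal (gain * stopped_sum \<omega> T + of_bool (active \<omega> T) * V (iter \<omega> T))" for \<omega>
      using V_nonneg[OF iter_in_Rn] by (intro ennreal_leI) simp
  qed simp
  also have "\<dots> = ennreal (?G + (V x0 + real T * loss_inc) / (gain * real T))"
    using G0 c0 V_nonneg[OF x0] loss_inc_nonneg
    by (subst ennreal_mult[symmetric], simp, simp, subst ennreal_plus[symmetric]) auto
  finally show ?thesis unfolding psac_measure_def .
qed

end

section \<open>The expected minimal gradient norm\<close>

lemma AE_unif_data_iff: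
  assumes "m \<ge> 1"
  shows "(AE i in unif_data m. P i) \<longleftrightarrow> (\<forall>i<m. P i)"
proof -
  have "set_pmf (pmf_of_set {..<m}) = {..<m}"
    using assms by (intro set_pmf_of_set) (auto simp: lessThan_empty_iff)
  show ?thesis
    unfolding unif_data_def AE_measure_pmf_iff \<open>set_pmf _ = _\<close> by auto
qed

lemma AE_psac_measure_batch:
  assumes m: "m \<ge> 1" and s: "C * \<sigma> > 0"
  shows "AE \<omega> in psac_measure d m B C \<sigma> T. \<forall>t\<in>{..<T}. \<forall>j\<in>{..<B}. fst (\<omega> t) j < m"
proof (rule AE_finite_allI)
  fix t assume t: "t \<in> {..<T}"
  interpret G: prob_space "gauss_measure d (C * \<sigma>)" by (rule prob_space_gauss[OF s])
  have "AE b in batch_measure m B. \<forall>j\<in>{..<B}. b j < m"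
    unfolding batch_measure_def
    by (intro AE_finite_allI AE_PiM_component prob_space_unif_data) (auto simp: AE_unif_data_iff[OF m])
  then have "AE b in distr (step_measure d m B (C * \<sigma>)) (batch_measure m B) fst. \<forall>j\<in>{..<B}. b j < m"
    unfolding G.distr_pair_fst .
  then have "AE p in step_measure d m B (C * \<sigma>). \<forall>j\<in>{..<B}. fst p j < m"
    by (rule AE_distrD[OF measurable_fst])
  then show "AE \<omega> in psac_measure d m B C \<sigma> T. \<forall>j\<in>{..<B}. fst (\<omega> t) j < m"
    unfolding psac_measure_def using t s by (intro AE_PiM_component prob_space_step)
qed simp

text \<open>Together with the almost sure bound on the sampled indices, this permits changing the
  losses outside the dataset.\<close>

lemma psac_cong_loss:
  assumes "\<And>s j. s < t \<Longrightarrow> j < B \<Longrightarrow> loss (fst (\<omega> s) j) = loss' (fst (\<omega> s) j)"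
  shows "psac d loss B C r \<eta> x0 \<omega> t = psac d loss' B C r \<eta> x0 \<omega> t"
  using assms
proof (induction t)
  case (Suc t)
  have iter: "psac d loss B C r \<eta> x0 \<omega> t = psac d loss' B C r \<eta> x0 \<omega> t"
    by (rule Suc.IH) (use Suc.prems in simp)
  have "loss (fst (\<omega> t) j) = loss' (fst (\<omega> t) j)" if "j < B" for j
    using Suc.prems[of t j] that by simp
  then have batch: "(\<Sum>j<B. clip d C r (grad d (loss (fst (\<omega> t) j)) x) i)
      = (\<Sum>j<B. clip d C r (grad d (loss' (fst (\<omega> t) j)) x) i)" for x i
    by (intro sum.cong) auto
  show ?case
    by (simp only: psac_Suc_step psac_step_def iter batch)
qed simp

text \<open>If \<open>f\<close> is not integrable, its Bochner integral is zero by convention and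
  \<open>c \<ge> 0\<close> gives the bound.\<close>

lemma integral_le_of_nn_integral_le:
  fixes f :: "'a \<Rightarrow> real"
  assumes "\<And>x. f x \<ge> 0" and c: "c \<ge> 0" and le: "(\<integral>\<^sup>+x. ennreal (f x) \<partial>M) \<le> ennreal c"
  shows "(\<integral>x. f x \<partial>M) \<le> c"
proof (cases "integrable M f")
  case True
  then have "ennreal (\<integral>x. f x \<partial>M) \<le> ennreal c"
    using le assms(1) by (simp add: nn_integral_eq_integral)
  then show ?thesis using c by (simp add: ennreal_le_iff)
next
  case False
  then show ?thesis using c by (simp add: not_integrable_integral_eq)
qed

text \<open>Forces at least one iteration, so that the minimum is over a nonempty set. One positive
  entry of the maximum is enough.\<close>

lemma A_threshold_pos:
  assumes "L0 > 0" "L1 \<ge> 0" "\<tau>0 > 0" "0 \<le> \<tau>1" "\<tau>1 < 1" "0 < r" "r \<le> 1"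
    "d \<ge> 1" "\<sigma> > 0" "B \<ge> 1"
  shows "A_threshold L0 L1 \<tau>0 \<tau>1 d r \<sigma> B > 0"
proof -
  have "r \<le> sqrt r" using assms by (simp add: real_le_rsqrt power2_eq_square mult_left_le)
  moreover have "0 < sqrt r" using assms by simp
  ultimately have rr: "0 \<le> sqrt r - r" "0 < 2 * sqrt r - r" by linarith+
  have N: "N_const \<tau>0 \<tau>1 r > 0"
    unfolding N_const_def using assms
    by (auto intro!: divide_pos_pos add_pos_pos add_pos_nonneg mult_pos_pos)
  have \<alpha>: "alpha_const \<tau>0 \<tau>1 r > 0"
    unfolding alpha_const_def using assms rr N
    by (auto intro!: mult_pos_pos divide_pos_pos add_pos_pos add_nonneg_pos)
  have \<Lambda>: "Lambda_const L0 L1 \<tau>0 > 0"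
    unfolding Lambda_const_def using assms by (auto intro!: add_pos_nonneg)
  have "L0 * (1 - \<tau>1) + L1 * (sqrt r - r + \<tau>0) > 0"
    using assms rr by (intro add_pos_nonneg mult_pos_pos mult_nonneg_nonneg) auto
  then have "0 < 32 * (real B)\<^sup>2 * (L0 * (1 - \<tau>1) + L1 * (sqrt r - r + \<tau>0))\<^sup>2 /
             (real d * \<sigma>\<^sup>2 * Lambda_const L0 L1 \<tau>0 * (2 * sqrt r - r)\<^sup>2 * (1 - \<tau>1)\<^sup>2 * (alpha_const \<tau>0 \<tau>1 r)\<^sup>2)"
    using assms rr \<alpha> \<Lambda> by (intro divide_pos_pos mult_pos_pos zero_less_power) auto
  then show ?thesis
    unfolding A_threshold_def Let_def by (subst Max_gr_iff) auto
qed

lemma expected_min_grad_le: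
  assumes L: "L0 > 0" "L1 \<ge> 0" and \<tau>: "\<tau>0 > 0" "0 \<le> \<tau>1" "\<tau>1 < 1" and r: "0 < r" "r \<le> 1" and C: "C > 0"
    and m: "m \<ge> 1" and B: "B \<ge> 1" and \<sigma>: "\<sigma> > 0" and T: "T \<ge> 1" and \<eta>: "\<eta> > 0"
    and diff: "\<forall>i<m. differentiable_Rn d (loss i)"
    and smooth: "gen_smooth d L0 L1 (avg_loss m loss)"
    and var: "bounded_variance d m \<tau>0 \<tau>1 loss"
    and x0: "x0 \<in> Rn d" and bdd: "bdd_below (avg_loss m loss ` Rn d)"
    and gap: "avg_loss m loss x0 - (INF y\<in>Rn d. avg_loss m loss y) \<le> \<Delta>"
    and D: "D = real d * \<sigma>\<^sup>2 / (real B)\<^sup>2"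
    and \<eta>_small: "\<eta> * C * L1 * (1 + D) \<le> clip_rate \<tau>0 \<tau>1"
  shows "(\<integral>\<omega>. Min ((\<lambda>t. vnorm d (grad d (avg_loss m loss) (psac d loss B C r (\<lambda>_. \<eta>) x0 \<omega> t))) ` {..<T})
        \<partial>psac_measure d m B C \<sigma> T)
    \<le> grad_floor \<tau>0 \<tau>1 + (\<Delta> + real T * (L0 / 2 * \<eta>\<^sup>2 * C\<^sup>2 * (1 + D))) / (\<eta> * C * clip_rate \<tau>0 \<tau>1 / 2 * real T)"
    (is "(\<integral>\<omega>. ?min loss \<omega> \<partial>_) \<le> ?bound \<Delta>")
proof -
  text \<open>Indices outside the dataset have probability zero, but the loss there need not be
    differentiable; redirecting them makes the iterates measurable.\<close>
  define loss' where "loss' = (\<lambda>k. loss (if k < m then k else 0))"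
  have avg: "avg_loss m loss' = avg_loss m loss"
    by (rule ext) (simp add: avg_loss_def loss'_def)
  have diff': "differentiable_Rn d (loss' k)" for k
    using diff m by (simp add: loss'_def)
  have dev: "vnorm d (grad d (loss' k) x - grad d (avg_loss m loss') x)
        \<le> \<tau>0 + \<tau>1 * vnorm d (grad d (avg_loss m loss') x)" if "x \<in> Rn d" for k x
    using var that m unfolding avg by (auto simp: bounded_variance_def AE_unif_data_iff[OF m] loss'_def)
  interpret psac_descent d m B loss' x0 L0 L1 \<tau>0 \<tau>1 r C \<sigma> \<eta>
    using assms diff' dev by unfold_locales (simp_all add: avg)
  have nonneg: "?min l \<omega> \<ge> 0" for l \<omega>
    using T by (subst Min_ge_iff) (auto simp: lessThan_empty_iff)
  have "(\<integral>\<^sup>+\<omega>. ennreal (?min loss \<omega>) \<partial>psac_measure d m B C \<sigma> T)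
      \<le> (\<integral>\<^sup>+\<omega>. ennreal (?min loss' \<omega>) \<partial>psac_measure d m B C \<sigma> T)"
  proof (rule nn_integral_mono_AE)
    \<comment> \<open>Almost surely only data points are sampled, and then both losses produce the
      same run.\<close>
    have "AE \<omega> in psac_measure d m B C \<sigma> T. \<forall>t\<in>{..<T}. \<forall>j\<in>{..<B}. fst (\<omega> t) j < m"
      using C \<sigma> m by (intro AE_psac_measure_batch) auto
    then show "AE \<omega> in psac_measure d m B C \<sigma> T. ennreal (?min loss \<omega>) \<le> ennreal (?min loss' \<omega>)"
    proof eventually_elim
      case (elim \<omega>)
      have "psac d loss B C r (\<lambda>_. \<eta>) x0 \<omega> t = psac d loss' B C r (\<lambda>_. \<eta>) x0 \<omega> t" if "t < T" for t
        by (rule psac_cong_loss) (use elim that in \<open>auto simp: loss'_def\<close>)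
      then have "?min loss \<omega> = ?min loss' \<omega>"
        by (intro arg_cong[where f = Min] image_cong) (auto simp: avg)
      then show ?case by simp
    qed
  qed
  also have "\<dots> \<le> ennreal (grad_floor \<tau>0 \<tau>1 + (V x0 + real T * loss_inc) / (gain * real T))"
    using nn_integral_Min_le[OF T] unfolding avg .
  also have "\<dots> \<le> ennreal (?bound \<Delta>)"
    unfolding gain_def[symmetric] loss_inc_def[folded D, symmetric]
    using gap gain_pos by (intro ennreal_leI add_left_mono divide_right_mono) (auto simp: V_def avg)
  finally have le: "(\<integral>\<^sup>+\<omega>. ennreal (?min loss \<omega>) \<partial>psac_measure d m B C \<sigma> T) \<le> ennreal (?bound \<Delta>)" .
  have "0 \<le> \<Delta>" using gap V_nonneg[OF x0] by (simp add: V_def avg)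
  then have "0 \<le> ?bound \<Delta>"
    using \<tau> L C \<eta> clip_rate_pos[OF \<tau>(1,3)]
    by (intro add_nonneg_nonneg divide_nonneg_nonneg mult_nonneg_nonneg) (auto simp: grad_floor_def D)
  then show ?thesis
    by (intro integral_le_of_nn_integral_le[OF nonneg] le)
qed

text \<open>The minimum includes the deterministic point \<open>x0\<close>. This serves the regime
  where the step size is not small enough for the descent.\<close>

lemma expected_min_grad_le_initial:
  assumes s: "C * \<sigma> > 0" and T: "T \<ge> 1"
  shows "(\<integral>\<omega>. Min ((\<lambda>t. vnorm d (grad d F (psac d loss B C r \<eta> x0 \<omega> t))) ` {..<T}) \<partial>psac_measure d m B C \<sigma> T)
    \<le> vnorm d (grad d F x0)"
proof (rule integral_le_of_nn_integral_le)
  let ?min = "\<lambda>\<omega>. Min ((\<lambda>t. vnorm d (grad d F (psac d loss B C r \<eta> x0 \<omega> t))) ` {..<T})"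
  interpret prob_space "psac_measure d m B C \<sigma> T" by (rule prob_space_psac[OF s])
  show "?min \<omega> \<ge> 0" for \<omega>
    using T by (subst Min_ge_iff) (auto simp: lessThan_empty_iff)
  have "?min \<omega> \<le> vnorm d (grad d F x0)" for \<omega>
    using T by (intro Min_le) (auto intro!: image_eqI[of _ _ 0])
  then have "(\<integral>\<^sup>+\<omega>. ennreal (?min \<omega>) \<partial>psac_measure d m B C \<sigma> T)
      \<le> (\<integral>\<^sup>+\<omega>. ennreal (vnorm d (grad d F x0)) \<partial>psac_measure d m B C \<sigma> T)"
    by (intro nn_integral_mono ennreal_leI)
  then show "(\<integral>\<^sup>+\<omega>. ennreal (?min \<omega>) \<partial>psac_measure d m B C \<sigma> T) \<le> ennreal (vnorm d (grad d F x0))"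
    by (simp add: emeasure_space_1)
qed simp

section \<open>Arithmetic of the step size\<close>

lemma root_4_eq_sqrt_sqrt: "root 4 x = sqrt (sqrt x)"
  using real_root_mult_exp[of 2 2 x] by (simp add: sqrt_def)

text \<open>\<open>p\<close> and \<open>q\<close> are the squares of the two fourth roots.
  Everything rests on \<open>\<eta> = sqrt (2 / \<Lambda>) * q\<close>, \<open>q * D = p\<close> and
  \<open>p * q * T = 1\<close>; the choice of \<open>\<eta>\<close> makes the accumulated curvature
  at most \<open>C\<^sup>2 * (1 + 1 / D)\<close>.\<close>

lemma step_size_bounds:
  assumes D: "D > 0" and T: "T > 0" and \<Lambda>: "\<Lambda> > 0" and C: "C > 0" and L0: "0 < L0" "L0 \<le> \<Lambda>"
    and c: "c > 0" and \<Delta>: "\<Delta> \<ge> 0"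
  defines "\<eta> \<equiv> sqrt (2 / (D * T * \<Lambda>))" and "p \<equiv> sqrt (D / T)" and "q \<equiv> sqrt (1 / (T * D))"
  shows "\<eta> * (1 + D) = sqrt (2 / \<Lambda>) * (p + q)"
    and "(\<Delta> + T * (L0 / 2 * \<eta>\<^sup>2 * C\<^sup>2 * (1 + D))) / (\<eta> * C * c / 2 * T)
      \<le> sqrt (2 * \<Lambda>) / (C * c) * (\<Delta> + C\<^sup>2) * (p + q)"
proof -
  have pos: "p > 0" "q > 0" "\<eta> > 0" using assms by auto
  have \<eta>_q: "\<eta> = sqrt (2 / \<Lambda>) * q"
    unfolding \<eta>_def q_def real_sqrt_mult[symmetric] by (simp add: field_simps)
  have qD: "q * D = p"
    using D T unfolding p_def q_def by (simp add: real_sqrt_divide real_sqrt_mult real_div_sqrt field_simps)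
  show "\<eta> * (1 + D) = sqrt (2 / \<Lambda>) * (p + q)"
    using qD by (simp add: \<eta>_q algebra_simps)
  have pq: "p * q * T = 1"
    using D T unfolding p_def q_def real_sqrt_mult[symmetric] by (simp add: real_sqrt_divide)
  have inv: "1 / (\<eta> / 2 * T) = sqrt (2 * \<Lambda>) * p"
  proof -
    have "sqrt (2 / \<Lambda>) * sqrt (2 * \<Lambda>) = 2"
      using \<Lambda> unfolding real_sqrt_mult[symmetric] by simp
    then have "sqrt (2 * \<Lambda>) * p * (\<eta> / 2 * T) = p * q * T"
      by (simp add: \<eta>_q mult_ac)
    then show ?thesis using pq pos T by (simp add: divide_eq_eq)
  qed
  have "\<eta>\<^sup>2 = 2 / (D * T * \<Lambda>)" using assms by simp
  then have "T * (L0 / 2 * \<eta>\<^sup>2 * C\<^sup>2 * (1 + D)) = T * (L0 / 2 * (2 / (D * T * \<Lambda>)) * C\<^sup>2 * (1 + D))"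
    by simp
  also have "\<dots> = L0 / \<Lambda> * (C\<^sup>2 * (1 + 1 / D))"
    using D T \<Lambda> by (simp add: field_simps)
  also have "\<dots> \<le> 1 * (C\<^sup>2 * (1 + 1 / D))"
    using L0 \<Lambda> D by (intro mult_right_mono) auto
  finally have num: "T * (L0 / 2 * \<eta>\<^sup>2 * C\<^sup>2 * (1 + D)) \<le> C\<^sup>2 * (1 + 1 / D)" by simp
  have "(\<Delta> + T * (L0 / 2 * \<eta>\<^sup>2 * C\<^sup>2 * (1 + D))) / (\<eta> * C * c / 2 * T)
      \<le> (\<Delta> + C\<^sup>2 * (1 + 1 / D)) / (\<eta> * C * c / 2 * T)"
    using num pos C c T by (intro divide_right_mono add_left_mono) auto
  also have "\<dots> = (\<Delta> + C\<^sup>2 * (1 + 1 / D)) / (C * c) * (1 / (\<eta> / 2 * T))"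
    by simp
  also have "\<dots> = sqrt (2 * \<Lambda>) / (C * c) * (\<Delta> * p + C\<^sup>2 * (p + p / D))"
  proof -
    have "\<Delta> * p + C\<^sup>2 * (p + p / D) = (\<Delta> + C\<^sup>2 * (1 + 1 / D)) * p"
      by (simp add: algebra_simps)
    then show ?thesis unfolding inv by simp
  qed
  also have "p / D = q" using qD D by (simp add: field_simps)
  also have "sqrt (2 * \<Lambda>) / (C * c) * (\<Delta> * p + C\<^sup>2 * (p + q))
      \<le> sqrt (2 * \<Lambda>) / (C * c) * ((\<Delta> + C\<^sup>2) * (p + q))"
    using \<Lambda> C c \<Delta> pos by (intro mult_left_mono) (auto simp: algebra_simps)
  finally show "(\<Delta> + T * (L0 / 2 * \<eta>\<^sup>2 * C\<^sup>2 * (1 + D))) / (\<eta> * C * c / 2 * T)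
      \<le> sqrt (2 * \<Lambda>) / (C * c) * (\<Delta> + C\<^sup>2) * (p + q)" by (simp add: mult_ac)
qed

theorem theorem2:
  fixes L0 L1 \<tau>0 \<tau>1 r C \<Delta> :: real
  assumes "L0 > 0" and "L1 \<ge> 0" and "\<tau>0 > 0" and "0 \<le> \<tau>1" and "\<tau>1 < 1"
    and "0 < r" and "r \<le> 1" and "C > 0"
  shows "\<exists>K\<ge>0. \<forall>(d::nat) (m::nat) (loss :: nat \<Rightarrow> rvec \<Rightarrow> real) (x0 :: rvec) (\<sigma>::real) (B::nat) (T::nat).
    d \<ge> 1 \<longrightarrow> m \<ge> 1 \<longrightarrow> B \<ge> 1 \<longrightarrow> \<sigma> > 0 \<longrightarrow>
    (\<forall>i<m. differentiable_Rn d (loss i)) \<longrightarrow>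
    gen_smooth d L0 L1 (avg_loss m loss) \<longrightarrow>
    bounded_variance d m \<tau>0 \<tau>1 loss \<longrightarrow>
    x0 \<in> Rn d \<longrightarrow>
    bdd_below (avg_loss m loss ` Rn d) \<longrightarrow>
    avg_loss m loss x0 - (INF y\<in>Rn d. avg_loss m loss y) \<le> \<Delta> \<longrightarrow>
    real T \<ge> A_threshold L0 L1 \<tau>0 \<tau>1 d r \<sigma> B \<longrightarrow>
    (let \<eta> = sqrt (2 * (real B)\<^sup>2 / (real d * \<sigma>\<^sup>2 * real T * (L0 + L1 * (\<tau>0 + 1)))) in
     (\<integral>\<omega>. Min ((\<lambda>t. vnorm d (grad d (avg_loss m loss) (psac d loss B C r (\<lambda>_. \<eta>) x0 \<omega> t))) ` {..<T})
        \<partial>psac_measure d m B C \<sigma> T)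
     \<le> K * (root 4 (real d * \<sigma>\<^sup>2 / (real T * (real B)\<^sup>2)) + root 4 ((real B)\<^sup>2 / (real T * real d * \<sigma>\<^sup>2)))
       + bias_term \<tau>0 \<tau>1 r)"
proof -
  define \<Lambda> where "\<Lambda> = L0 + L1 * (\<tau>0 + 1)"
  define c where "c = clip_rate \<tau>0 \<tau>1"
  have \<Lambda>: "\<Lambda> > 0" "L0 \<le> \<Lambda>" unfolding \<Lambda>_def using assms by (auto intro!: add_pos_nonneg)
  have c: "c > 0" unfolding c_def using assms by (intro clip_rate_pos)
  have bias: "0 \<le> grad_floor \<tau>0 \<tau>1" "grad_floor \<tau>0 \<tau>1 \<le> bias_term \<tau>0 \<tau>1 r"
    using assms by (simp_all add: grad_floor_le_bias_term) (simp add: grad_floor_def)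
  text \<open>The descent argument applies while \<open>sqrt (D / T)\<close> and \<open>1 / sqrt (D T)\<close> are at most \<open>\<kappa>\<close>; otherwise
    the fourth roots are bounded away from zero.\<close>
  define \<kappa> where "\<kappa> = min 1 (c / (2 * sqrt (2 / \<Lambda>) * C * (L1 + 1)))"
  have \<kappa>: "\<kappa> > 0" "\<kappa> \<le> 1" unfolding \<kappa>_def using c \<Lambda> assms by auto
  \<comment> \<open>\<open>K1\<close> is the coefficient from \<open>step_size_bounds\<close>, and
    \<open>U\<close> below bounds the initial gradient norm. The absolute value keeps the constants
    nonnegative, as they are fixed before \<open>\<Delta> \<ge> 0\<close> is known.\<close>
  define K1 where "K1 = sqrt (2 * \<Lambda>) / (C * c) * (\<bar>\<Delta>\<bar> + C\<^sup>2)"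
  define U where "U = 1 + 2 * \<bar>\<Delta>\<bar> * (L0 + L1)"
  define K where "K = K1 + U / sqrt \<kappa>"
  have K1: "K1 \<ge> 0" unfolding K1_def using \<Lambda> c assms by simp
  have U: "U \<ge> 0" unfolding U_def using assms by simp
  have K0: "K \<ge> 0" "K1 \<le> K" "U / sqrt \<kappa> \<le> K" unfolding K_def using K1 U \<kappa> by auto
  show ?thesis
  proof (intro exI[of _ K] conjI allI impI K0(1))
    fix d m :: nat and loss :: "nat \<Rightarrow> rvec \<Rightarrow> real" and x0 :: rvec and \<sigma> :: real and B T :: nat
    assume d: "d \<ge> 1" and m: "m \<ge> 1" and B: "B \<ge> 1" and \<sigma>: "\<sigma> > 0"
      and diff: "\<forall>i<m. differentiable_Rn d (loss i)"
      and smooth: "gen_smooth d L0 L1 (avg_loss m loss)"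
      and var: "bounded_variance d m \<tau>0 \<tau>1 loss"
      and x0: "x0 \<in> Rn d" and bdd: "bdd_below (avg_loss m loss ` Rn d)"
      and gap: "avg_loss m loss x0 - (INF y\<in>Rn d. avg_loss m loss y) \<le> \<Delta>"
      and T: "real T \<ge> A_threshold L0 L1 \<tau>0 \<tau>1 d r \<sigma> B"
    have T1: "T \<ge> 1"
      using A_threshold_pos[OF assms(1-7) d \<sigma> B] T by simp
    have low: "avg_loss m loss x0 - avg_loss m loss y \<le> \<Delta>" if "y \<in> Rn d" for y
      using cINF_lower[OF bdd that] gap by linarith
    \<comment> \<open>The gap bound at \<open>y = x0\<close> forces nonnegativity, so the absolute
      values in \<open>K1\<close> and \<open>U\<close> disappear.\<close>
    have \<Delta>: "\<Delta> \<ge> 0" using low[OF x0] by simp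
    define D where "D = real d * \<sigma>\<^sup>2 / (real B)\<^sup>2"
    have D: "D > 0" unfolding D_def using d \<sigma> B by simp
    define p where "p = sqrt (D / real T)"
    define q where "q = sqrt (1 / (real T * D))"
    define \<eta> where "\<eta> = sqrt (2 / (D * real T * \<Lambda>))"
    have pq: "p > 0" "q > 0" unfolding p_def q_def using D T1 by auto
    have \<eta>_eq: "sqrt (2 * (real B)\<^sup>2 / (real d * \<sigma>\<^sup>2 * real T * (L0 + L1 * (\<tau>0 + 1)))) = \<eta>"
      unfolding \<eta>_def D_def \<Lambda>_def by simp
    have p_eq: "root 4 (real d * \<sigma>\<^sup>2 / (real T * (real B)\<^sup>2)) = sqrt p"
      unfolding root_4_eq_sqrt_sqrt p_def D_def by (simp add: mult.commute)
    have q_eq: "root 4 ((real B)\<^sup>2 / (real T * real d * \<sigma>\<^sup>2)) = sqrt q"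
      unfolding root_4_eq_sqrt_sqrt q_def D_def by (simp add: mult.assoc)
    let ?E = "\<integral>\<omega>. Min ((\<lambda>t. vnorm d (grad d (avg_loss m loss) (psac d loss B C r (\<lambda>_. \<eta>) x0 \<omega> t))) ` {..<T})
        \<partial>psac_measure d m B C \<sigma> T"
    have "?E \<le> K * (sqrt p + sqrt q) + bias_term \<tau>0 \<tau>1 r"
    proof (cases "p \<le> \<kappa> \<and> q \<le> \<kappa>")
      case True
      have \<eta>: "\<eta> > 0" unfolding \<eta>_def using D T1 \<Lambda> by simp
      note arith = step_size_bounds[of D "real T" \<Lambda> C L0 c \<Delta>, folded \<eta>_def p_def q_def]
      have "\<eta> * (1 + D) = sqrt (2 / \<Lambda>) * (p + q)"
        using arith(1) D T1 \<Lambda> assms c \<Delta> by simp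
      also have "\<dots> \<le> sqrt (2 / \<Lambda>) * (2 * \<kappa>)"
        using True \<Lambda> by (intro mult_left_mono) auto
      \<comment> \<open>The second entry of the minimum in \<open>\<kappa>\<close> is tailored to
        the step-size condition; \<open>L1 + 1\<close> instead of \<open>L1\<close> avoids division
        by zero.\<close>
      also have "\<dots> \<le> sqrt (2 / \<Lambda>) * (2 * (c / (2 * sqrt (2 / \<Lambda>) * C * (L1 + 1))))"
        using \<Lambda> by (intro mult_left_mono) (auto simp: \<kappa>_def)
      also have "\<dots> = c / (C * (L1 + 1))"
        using \<Lambda> by simp
      finally have "\<eta> * (1 + D) * (C * L1) \<le> c / (C * (L1 + 1)) * (C * L1)"
        using assms by (intro mult_right_mono) auto
      also have "\<dots> = c * (L1 / (L1 + 1))" using assms by simp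
      also have "\<dots> \<le> c" using c assms by (intro mult_left_le) auto
      finally have small: "\<eta> * C * L1 * (1 + D) \<le> clip_rate \<tau>0 \<tau>1"
        unfolding c_def by (simp add: mult_ac)
      have "?E \<le> grad_floor \<tau>0 \<tau>1 + (\<Delta> + real T * (L0 / 2 * \<eta>\<^sup>2 * C\<^sup>2 * (1 + D))) / (\<eta> * C * c / 2 * real T)"
        unfolding c_def
        by (rule expected_min_grad_le[OF assms m B \<sigma> T1 \<eta> diff smooth var x0 bdd gap D_def small])
      also have "\<dots> \<le> grad_floor \<tau>0 \<tau>1 + K1 * (p + q)"
        using arith(2) D T1 \<Lambda> assms c \<Delta> by (simp add: K1_def)
      also have "K1 * (p + q) \<le> K1 * (sqrt p + sqrt q)"
      proof -
        \<comment> \<open>Both quantities are at most \<open>\<kappa> \<le> 1\<close>, so passing to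
          square roots, that is to the fourth roots of the claim, only increases them.\<close>
        have "p \<le> sqrt p" "q \<le> sqrt q"
          using True \<kappa> pq by (auto intro!: real_le_rsqrt simp: power2_eq_square mult_left_le)
        then show ?thesis using K1 by (intro mult_left_mono) auto
      qed
      also have "K1 * (sqrt p + sqrt q) \<le> K * (sqrt p + sqrt q)"
        using K0 pq by (intro mult_right_mono) auto
      finally show ?thesis using bias by simp
    next
      case False
      \<comment> \<open>At least one of \<open>p\<close> and \<open>q\<close> exceeds
        \<open>\<kappa>\<close>, so the term \<open>U / sqrt \<kappa>\<close> in \<open>K\<close>
        makes the O-term at least \<open>U\<close>.\<close>
      then have "sqrt \<kappa> \<le> sqrt p + sqrt q"
        using pq by (auto simp: not_le intro: add_increasing add_increasing2)
      then have "U / sqrt \<kappa> * sqrt \<kappa> \<le> K * (sqrt p + sqrt q)"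
        using K0 U \<kappa> by (intro mult_mono) auto
      then have "U \<le> K * (sqrt p + sqrt q)" using \<kappa> by simp
      moreover have "?E \<le> vnorm d (grad d (avg_loss m loss) x0)"
        using assms \<sigma> T1 by (intro expected_min_grad_le_initial) auto
      moreover have "vnorm d (grad d (avg_loss m loss) x0) \<le> U"
        using gen_smooth_grad_bound[OF differentiable_avg_loss smooth assms(1,2) x0 low] diff \<Delta>
        by (simp add: U_def)
      ultimately show ?thesis using bias by linarith
    qed
    then show "let \<eta> = sqrt (2 * (real B)\<^sup>2 / (real d * \<sigma>\<^sup>2 * real T * (L0 + L1 * (\<tau>0 + 1)))) in
     (\<integral>\<omega>. Min ((\<lambda>t. vnorm d (grad d (avg_loss m loss) (psac d loss B C r (\<lambda>_. \<eta>) x0 \<omega> t))) ` {..<T})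
        \<partial>psac_measure d m B C \<sigma> T)
     \<le> K * (root 4 (real d * \<sigma>\<^sup>2 / (real T * (real B)\<^sup>2)) + root 4 ((real B)\<^sup>2 / (real T * real d * \<sigma>\<^sup>2)))
       + bias_term \<tau>0 \<tau>1 r"
      unfolding Let_def \<eta>_eq p_eq q_eq .
  qed
qed

end
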